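(* Let $\mathbf{i}=(i_1,\dots,i_N)$ be a reduced word of the longest element $w_0$ and let $i\in I$ be such that $\langle h_t,\mu\rangle\in\{1,0,-1\}$ for every weight $\mu$ of $V(-w_0\Lambda_i)$ and every $t\in I$ (i.e. $V(-w_0\Lambda_i)$ is minuscule). Then the directed graphs $\overline{DG}$ and $DG$ (both defined in the context, for $\mathbf{i}$ and $i$) coincide.
   Context: $G$ is a simply connected connected simple algebraic group over $\mathbb{C}$ with Lie algebra $\mathfrak{g}$, Weyl group $W$ with simple reflections $s_i$ ($i\in I=\{1,\dots,n\}$), longest element $w_0$, $N=l(w_0)$; $h_i$ are simple coroots, $\alpha_i$ simple roots, $\Lambda_i$ fundamental weights ($\langle h_j,\Lambda_i\rangle=\delta_{ij}$), $a_{i,j}=\langle h_i,\alpha_j\rangle$. $V(\lambda)$ is the finite dimensional irreducible $\mathfrak{g}$-module of highest weight $\lambda$. Write $[1,N]=\{1,\dots,N\}$. For $j\in[1,N]$: $j^+=\min(\{l\in[1,N]: i_l=i_j,\ l>j\}\cup\{N+1\})$; $j^{0+}=j$, $j^{m+}=(j^{(m-1)+})^+$ for $m\ge1$, with $(N+1)^+=N+1$. For $j$ with $j^+\le N$, $A_j=t_jt_{j^+}\prod_{j<l<j^+}t_l^{a_{i_l,i_j}}$, a Laurent monomial in $t_1,\dots,t_N$. Let $k\in[1,N]$ be such that $s_{i_N}s_{i_{N-1}}\cdots s_{i_{k+1}}\alpha_{i_k}=\alpha_i$. A sink of a directed graph is a vertex with no outgoing arrow. Vertices are labelled by Laurent monomials;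 equal monomials define the same vertex. Graph $\overline{DG}$: (1) $\overline{DG}_0$ has the single vertex $t_k$ and no arrow; $t_k$ is associated with the vector $(b^0_1,\dots,b^0_N)$, $b^0_t=\langle h_{i_t},s_{i_{t+1}}\cdots s_{i_N}s_i\Lambda_i\rangle$ for $k<t\le N$, $b^0_k=0$, $b^0_t=\langle h_{i_t},s_{i_{t+1}}\cdots s_{i_N}\Lambda_i\rangle$ for $1\le t<k$. (2) For each sink $M=\prod_j t_j^{d_j}$ of $\overline{DG}_l$ with associated vector $(b_1,\dots,b_N)$ and each $j\in[1,N]$ with $j^+\le N$, add a vertex $M\cdot A_j^{-1}$ and an arrow $M\to M\cdot A_j^{-1}$ if and only if $d_j>0$, $b_{j^+}>0$ and either (a) $d_{j^+}<d_j$, or (b) $d_{j^+}=d_j$ and there is $p\ge2$ with $j^{p+}\le N$, $d_{j^{m+}}=b_{j^{m+}}=0$ for $m=2,\dots,p-1$, and $d_{j^{p+}}=-1$, $b_{j^{p+}}=1$. To $M\cdot A_j^{-1}$ associate $b'_s=b_s$ ($s\ne j,j^+$), $b'_j=b_j+1$, $b'_{j^+}=b_{j^+}-1$. The result is $\overline{DG}_{l+1}$. (3) When no sink of $\overline{DG}_r$ satisfies the condition in (2), set $\overline{DG}=\overline{DG}_r$. Graph $DG$: start with the graph with the single vertex $t_k$ and no arrow; repeatedly, for each sink $M=\prod_j t_j^{d_j}$ of the current graph and each $j\in[1,N]$ with $j^+\le N$, add a vertex $M\cdot A_j^{-1}$ and an arrow $M\to M\cdot A_j^{-1}$ if and only if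 $d_j=1$ and $d_{j^+}\neq1$; stop when no sink admits such a $j$, and call the resulting graph $DG$. *)

theory Defs
  imports Complex_Main "HOL-Library.While_Combinator"
begin

section \<open>Simple Lie algebras, roots and coroots\<close>

locale lie_algebra = vector_space scale
  for scale :: "complex \<Rightarrow> 'g::ab_group_add \<Rightarrow> 'g" +
  fixes bracket :: "'g \<Rightarrow> 'g \<Rightarrow> 'g"
  assumes bracket_linear_left: "Vector_Spaces.linear scale scale (\<lambda>x. bracket x y)"
    and bracket_linear_right: "Vector_Spaces.linear scale scale (bracket x)"
    and bracket_self: "bracket x x = 0"
    and jacobi: "bracket x (bracket y z) + bracket y (bracket z x) + bracket z (bracket x y) = 0"

definition (in lie_algebra) lie_ideal :: "'g set \<Rightarrow> bool" where
  "lie_ideal J \<longleftrightarrow> subspace J \<and> (\<forall>x. \<forall>y\<in>J. bracket x y \<in> J)"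

locale simple_lie_algebra = lie_algebra scale bracket
  for scale :: "complex \<Rightarrow> 'g::ab_group_add \<Rightarrow> 'g" and bracket +
  assumes finite_dimensional: "\<exists>B. finite B \<and> span B = UNIV"
    and not_abelian: "\<exists>x y. bracket x y \<noteq> 0"
    and ideal_trivial: "lie_ideal J \<Longrightarrow> J = {0} \<or> J = UNIV"

context lie_algebra
begin

definition ad_semisimple :: "'g \<Rightarrow> bool" where
  "ad_semisimple x \<longleftrightarrow> span {y. \<exists>c. bracket x y = scale c y} = UNIV"

text \<open>In a semisimple Lie algebra: a toral subalgebra (commutative, consisting of semisimple
  elements) which is its own centralizer.\<close>

definition cartan_subalgebra :: "'g set \<Rightarrow> bool" where
  "cartan_subalgebra H \<longleftrightarrow> subspace H
     \<and> (\<forall>x\<in>H. \<forall>y\<in>H. bracket x y = 0)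
     \<and> (\<forall>x\<in>H. ad_semisimple x)
     \<and> {x. \<forall>y\<in>H. bracket x y = 0} = H"

text \<open>A linear functional on \<open>H\<close> is represented by its extension by zero to the whole type, so
  that equality of functionals is equality of functions.\<close>

definition dual :: "'g set \<Rightarrow> ('g \<Rightarrow> complex) set" where
  "dual H = {\<mu>. (\<forall>x\<in>H. \<forall>y\<in>H. \<mu> (x + y) = \<mu> x + \<mu> y)
               \<and> (\<forall>c. \<forall>x\<in>H. \<mu> (scale c x) = c * \<mu> x)
               \<and> (\<forall>x. x \<notin> H \<longrightarrow> \<mu> x = 0)}"

definition root_space :: "'g set \<Rightarrow> ('g \<Rightarrow> complex) \<Rightarrow> 'g set" where
  "root_space H \<beta> = {x. \<forall>y\<in>H. bracket y x = scale (\<beta> y) x}"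

definition roots :: "'g set \<Rightarrow> ('g \<Rightarrow> complex) set" where
  "roots H = {\<beta> \<in> dual H. \<beta> \<noteq> (\<lambda>x. 0) \<and> root_space H \<beta> \<noteq> {0}}"

definition positive_roots :: "'g set \<Rightarrow> nat \<Rightarrow> (nat \<Rightarrow> 'g \<Rightarrow> complex) \<Rightarrow> ('g \<Rightarrow> complex) set" where
  "positive_roots H n \<alpha> = {\<beta> \<in> roots H. \<exists>c :: nat \<Rightarrow> nat. \<beta> = (\<lambda>x. \<Sum>i=1..n. of_nat (c i) * \<alpha> i x)}"

definition negative_roots :: "'g set \<Rightarrow> nat \<Rightarrow> (nat \<Rightarrow> 'g \<Rightarrow> complex) \<Rightarrow> ('g \<Rightarrow> complex) set" where
  "negative_roots H n \<alpha> = {\<beta> \<in> roots H. \<exists>c :: nat \<Rightarrow> nat. \<beta> = (\<lambda>x. - (\<Sum>i=1..n. of_nat (c i) * \<alpha> i x))}"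

text \<open>\<open>\<alpha> 1, \<dots>, \<alpha> n\<close> are roots, form a basis of the dual of \<open>H\<close>, and every root is a combination of
  them with integer coefficients of the same sign.\<close>

definition simple_roots :: "'g set \<Rightarrow> nat \<Rightarrow> (nat \<Rightarrow> 'g \<Rightarrow> complex) \<Rightarrow> bool" where
  "simple_roots H n \<alpha> \<longleftrightarrow>
     (\<forall>i\<in>{1..n}. \<alpha> i \<in> roots H)
     \<and> (\<forall>c. (\<lambda>x. \<Sum>i=1..n. c i * \<alpha> i x) = (\<lambda>x. 0) \<longrightarrow> (\<forall>i\<in>{1..n}. c i = 0))
     \<and> (\<forall>\<mu>\<in>dual H. \<exists>c. \<mu> = (\<lambda>x. \<Sum>i=1..n. c i * \<alpha> i x))
     \<and> roots H = positive_roots H n \<alpha> \<union> negative_roots H n \<alpha>"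

text \<open>The coroot of \<open>\<beta>\<close> is the element of \<open>[g\<^sub>\<beta>, g\<^sub>-\<^sub>\<beta>]\<close> on which \<open>\<beta>\<close> takes the value 2.  As these
  spaces are one-dimensional, it is itself a bracket.\<close>

definition coroot :: "'g set \<Rightarrow> ('g \<Rightarrow> complex) \<Rightarrow> 'g \<Rightarrow> bool" where
  "coroot H \<beta> h \<longleftrightarrow> \<beta> h = 2 \<and>
     (\<exists>e \<in> root_space H \<beta>. \<exists>f \<in> root_space H (\<lambda>x. - \<beta> x). h = bracket e f)"

definition fundamental_weights ::
    "'g set \<Rightarrow> nat \<Rightarrow> (nat \<Rightarrow> 'g) \<Rightarrow> (nat \<Rightarrow> 'g \<Rightarrow> complex) \<Rightarrow> bool" where
  "fundamental_weights H n h \<Lambda> \<longleftrightarrow>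
     (\<forall>i\<in>{1..n}. \<Lambda> i \<in> dual H \<and> (\<forall>j\<in>{1..n}. \<Lambda> i (h j) = (if i = j then 1 else 0)))"

end


section \<open>Modules and weights\<close>

locale lie_module = lie_algebra scale bracket + V: vector_space scaleV
  for scale :: "complex \<Rightarrow> 'g::ab_group_add \<Rightarrow> 'g" and bracket
    and scaleV :: "complex \<Rightarrow> 'v::ab_group_add \<Rightarrow> 'v" +
  fixes act :: "'g \<Rightarrow> 'v \<Rightarrow> 'v"
  assumes act_linear_left: "Vector_Spaces.linear scale scaleV (\<lambda>x. act x v)"
    and act_linear_right: "Vector_Spaces.linear scaleV scaleV (act x)"
    and act_bracket: "act (bracket x y) v = act x (act y v) - act y (act x v)"
begin

definition irreducible_module :: bool where
  "irreducible_module \<longleftrightarrow> (\<exists>v::'v. v \<noteq> 0) \<and>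
     (\<forall>U. V.subspace U \<and> (\<forall>x. \<forall>u\<in>U. act x u \<in> U) \<longrightarrow> U = {0} \<or> U = UNIV)"

definition weight_space :: "'g set \<Rightarrow> ('g \<Rightarrow> complex) \<Rightarrow> 'v set" where
  "weight_space H \<mu> = {v. \<forall>y\<in>H. act y v = scaleV (\<mu> y) v}"

definition weights :: "'g set \<Rightarrow> ('g \<Rightarrow> complex) set" where
  "weights H = {\<mu> \<in> dual H. weight_space H \<mu> \<noteq> {0}}"

definition has_highest_weight ::
    "'g set \<Rightarrow> nat \<Rightarrow> (nat \<Rightarrow> 'g \<Rightarrow> complex) \<Rightarrow> ('g \<Rightarrow> complex) \<Rightarrow> bool" where
  "has_highest_weight H n \<alpha> \<nu> \<longleftrightarrow> \<nu> \<in> dual H \<and>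
     (\<exists>v \<in> weight_space H \<nu>. v \<noteq> 0 \<and>
        (\<forall>\<beta> \<in> positive_roots H n \<alpha>. \<forall>x \<in> root_space H \<beta>. act x v = 0))"

text \<open>The module is a realization of \<open>V(\<nu>)\<close>.\<close>

definition is_V :: "'g set \<Rightarrow> nat \<Rightarrow> (nat \<Rightarrow> 'g \<Rightarrow> complex) \<Rightarrow> ('g \<Rightarrow> complex) \<Rightarrow> bool" where
  "is_V H n \<alpha> \<nu> \<longleftrightarrow> (\<exists>B. finite B \<and> V.span B = UNIV)
     \<and> irreducible_module \<and> has_highest_weight H n \<alpha> \<nu>"

end


section \<open>The Weyl group\<close>

definition simple_reflection ::
    "(nat \<Rightarrow> 'g) \<Rightarrow> (nat \<Rightarrow> 'g \<Rightarrow> complex) \<Rightarrow> nat \<Rightarrow> ('g \<Rightarrow> complex) \<Rightarrow> ('g \<Rightarrow> complex)" where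
  "simple_reflection h \<alpha> i \<mu> = (\<lambda>x. \<mu> x - \<mu> (h i) * \<alpha> i x)"

text \<open>The product \<open>s\<^sub>j\<^sub>1 \<circ> \<dots> \<circ> s\<^sub>j\<^sub>r\<close> for the word \<open>[j\<^sub>1, \<dots>, j\<^sub>r]\<close>.  It is defined on all functions;
  since functions vanishing at all simple coroots are fixed, two such products agree as soon as they
  agree on the dual of the Cartan subalgebra.\<close>

definition weyl_word ::
    "(nat \<Rightarrow> 'g) \<Rightarrow> (nat \<Rightarrow> 'g \<Rightarrow> complex) \<Rightarrow> nat list \<Rightarrow> ('g \<Rightarrow> complex) \<Rightarrow> ('g \<Rightarrow> complex)" where
  "weyl_word h \<alpha> js = foldr (\<lambda>j w. simple_reflection h \<alpha> j \<circ> w) js id"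

definition weyl_group ::
    "(nat \<Rightarrow> 'g) \<Rightarrow> (nat \<Rightarrow> 'g \<Rightarrow> complex) \<Rightarrow> nat \<Rightarrow> (('g \<Rightarrow> complex) \<Rightarrow> ('g \<Rightarrow> complex)) set" where
  "weyl_group h \<alpha> n = {weyl_word h \<alpha> js | js. set js \<subseteq> {1..n}}"

definition weyl_length ::
    "(nat \<Rightarrow> 'g) \<Rightarrow> (nat \<Rightarrow> 'g \<Rightarrow> complex) \<Rightarrow> nat \<Rightarrow> (('g \<Rightarrow> complex) \<Rightarrow> ('g \<Rightarrow> complex)) \<Rightarrow> nat" where
  "weyl_length h \<alpha> n w =
     (LEAST l. \<exists>js. set js \<subseteq> {1..n} \<and> length js = l \<and> weyl_word h \<alpha> js = w)"

definition longest_element ::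
    "(nat \<Rightarrow> 'g) \<Rightarrow> (nat \<Rightarrow> 'g \<Rightarrow> complex) \<Rightarrow> nat \<Rightarrow> (('g \<Rightarrow> complex) \<Rightarrow> ('g \<Rightarrow> complex)) \<Rightarrow> bool" where
  "longest_element h \<alpha> n w0 \<longleftrightarrow> w0 \<in> weyl_group h \<alpha> n \<and>
     (\<forall>w \<in> weyl_group h \<alpha> n. weyl_length h \<alpha> n w \<le> weyl_length h \<alpha> n w0)"

definition reduced_word ::
    "(nat \<Rightarrow> 'g) \<Rightarrow> (nat \<Rightarrow> 'g \<Rightarrow> complex) \<Rightarrow> nat \<Rightarrow> nat list \<Rightarrow> (('g \<Rightarrow> complex) \<Rightarrow> ('g \<Rightarrow> complex)) \<Rightarrow> bool" where
  "reduced_word h \<alpha> n js w \<longleftrightarrow>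
     set js \<subseteq> {1..n} \<and> weyl_word h \<alpha> js = w \<and> length js = weyl_length h \<alpha> n w"

text \<open>The integer value of a pairing; used only for complex numbers that are integers.\<close>

definition int_val :: "complex \<Rightarrow> int" where
  "int_val c = (THE z. of_int z = c)"

definition cartan_entry :: "(nat \<Rightarrow> 'g) \<Rightarrow> (nat \<Rightarrow> 'g \<Rightarrow> complex) \<Rightarrow> nat \<Rightarrow> nat \<Rightarrow> int" where
  "cartan_entry h \<alpha> i j = int_val (\<alpha> j (h i))"


section \<open>Laurent monomials\<close>

text \<open>The monomial \<open>\<Prod>\<^sub>j t\<^sub>j\<^bsup>d j\<^esup>\<close> with \<open>j\<close> ranging over \<open>{1..N}\<close> is represented by its exponent vector
  \<open>d\<close>, which vanishes outside \<open>{1..N}\<close>.  Words are lists, positions in them are counted from 1.\<close>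

type_synonym monomial = "nat \<Rightarrow> int"

definition letter :: "nat list \<Rightarrow> nat \<Rightarrow> nat" where
  "letter ii j = ii ! (j - 1)"

definition next_pos :: "nat list \<Rightarrow> nat \<Rightarrow> nat" where
  "next_pos ii j =
     Min ({l \<in> {1..length ii}. letter ii l = letter ii j \<and> l > j} \<union> {length ii + 1})"

definition A_mono :: "(nat \<Rightarrow> nat \<Rightarrow> int) \<Rightarrow> nat list \<Rightarrow> nat \<Rightarrow> monomial" where
  "A_mono a ii j = (\<lambda>l. if l = j \<or> l = next_pos ii j then 1
                        else if j < l \<and> l < next_pos ii j then a (letter ii l) (letter ii j)
                        else 0)"

definition div_A :: "(nat \<Rightarrow> nat \<Rightarrow> int) \<Rightarrow> nat list \<Rightarrow> monomial \<Rightarrow> nat \<Rightarrow> monomial" where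
  "div_A a ii M j = (\<lambda>l. M l - A_mono a ii j l)"

definition t_mono :: "nat \<Rightarrow> monomial" where
  "t_mono k = (\<lambda>l. if l = k then 1 else 0)"


section \<open>The graphs\<close>

text \<open>A directed graph is given by its set of vertices and its set of arrows.\<close>

type_synonym graph = "monomial set \<times> (monomial \<times> monomial) set"

definition sinks :: "graph \<Rightarrow> monomial set" where
  "sinks D = {M \<in> fst D. \<forall>M'. (M, M') \<notin> snd D}"

definition DG_moves :: "nat list \<Rightarrow> graph \<Rightarrow> (monomial \<times> nat) set" where
  "DG_moves ii D = {(M, j). M \<in> sinks D \<and> j \<in> {1..length ii} \<and> next_pos ii j \<le> length ii
                      \<and> M j = 1 \<and> M (next_pos ii j) \<noteq> 1}"

definition DG_step :: "(nat \<Rightarrow> nat \<Rightarrow> int) \<Rightarrow> nat list \<Rightarrow> graph \<Rightarrow> graph" where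
  "DG_step a ii D =
     (fst D \<union> (\<lambda>(M, j). div_A a ii M j) ` DG_moves ii D,
      snd D \<union> (\<lambda>(M, j). (M, div_A a ii M j)) ` DG_moves ii D)"

text \<open>The value is \<open>None\<close> if the procedure does not stop.\<close>

definition DG :: "(nat \<Rightarrow> nat \<Rightarrow> int) \<Rightarrow> nat list \<Rightarrow> nat \<Rightarrow> graph option" where
  "DG a ii k = while_option (\<lambda>D. DG_moves ii D \<noteq> {}) (DG_step a ii) ({t_mono k}, {})"

text \<open>A state of the construction of \<open>DG_bar\<close> is a graph together with the association of
  vectors to its vertices, which is kept as a relation.\<close>

type_synonym assoc_graph = "graph \<times> (monomial \<times> (nat \<Rightarrow> int)) set"

definition bar_cond :: "nat list \<Rightarrow> monomial \<Rightarrow> (nat \<Rightarrow> int) \<Rightarrow> nat \<Rightarrow> bool" where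
  "bar_cond ii d b j \<longleftrightarrow> (let j' = next_pos ii j; pos = (\<lambda>m. (next_pos ii ^^ m) j) in
     d j > 0 \<and> b j' > 0 \<and>
     (d j' < d j \<or>
      d j' = d j \<and> (\<exists>p\<ge>2. pos p \<le> length ii
         \<and> (\<forall>m\<in>{2..p-1}. d (pos m) = 0 \<and> b (pos m) = 0)
         \<and> d (pos p) = -1 \<and> b (pos p) = 1)))"

definition bar_moves :: "nat list \<Rightarrow> assoc_graph \<Rightarrow> (monomial \<times> (nat \<Rightarrow> int) \<times> nat) set" where
  "bar_moves ii S = {(M, b, j). M \<in> sinks (fst S) \<and> (M, b) \<in> snd S
                       \<and> j \<in> {1..length ii} \<and> next_pos ii j \<le> length ii \<and> bar_cond ii M b j}"

definition bar_vector :: "nat list \<Rightarrow> (nat \<Rightarrow> int) \<Rightarrow> nat \<Rightarrow> (nat \<Rightarrow> int)" where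
  "bar_vector ii b j = b(j := b j + 1, next_pos ii j := b (next_pos ii j) - 1)"

definition bar_step :: "(nat \<Rightarrow> nat \<Rightarrow> int) \<Rightarrow> nat list \<Rightarrow> assoc_graph \<Rightarrow> assoc_graph" where
  "bar_step a ii S =
     ((fst (fst S) \<union> (\<lambda>(M, b, j). div_A a ii M j) ` bar_moves ii S,
       snd (fst S) \<union> (\<lambda>(M, b, j). (M, div_A a ii M j)) ` bar_moves ii S),
      snd S \<union> (\<lambda>(M, b, j). (div_A a ii M j, bar_vector ii b j)) ` bar_moves ii S)"

definition DG_bar :: "(nat \<Rightarrow> nat \<Rightarrow> int) \<Rightarrow> nat list \<Rightarrow> nat \<Rightarrow> (nat \<Rightarrow> int) \<Rightarrow> graph option" where
  "DG_bar a ii k b0 = map_option fst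
     (while_option (\<lambda>S. bar_moves ii S \<noteq> {}) (bar_step a ii)
        (({t_mono k}, {}), {(t_mono k, b0)}))"

definition initial_vector ::
    "(nat \<Rightarrow> 'g) \<Rightarrow> (nat \<Rightarrow> 'g \<Rightarrow> complex) \<Rightarrow> (nat \<Rightarrow> 'g \<Rightarrow> complex) \<Rightarrow> nat list \<Rightarrow> nat \<Rightarrow> nat \<Rightarrow> (nat \<Rightarrow> int)" where
  "initial_vector h \<alpha> \<Lambda> ii i k = (\<lambda>t.
     if k < t \<and> t \<le> length ii
       then int_val (weyl_word h \<alpha> (drop t ii @ [i]) (\<Lambda> i) (h (letter ii t)))
     else if 1 \<le> t \<and> t < k
       then int_val (weyl_word h \<alpha> (drop t ii) (\<Lambda> i) (h (letter ii t)))
     else 0)"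

end

theory Submission
  imports Defs
begin

text \<open>
  The vectors attached to the vertices of \<open>DG_bar\<close> are step vectors of paths in the weight
  diagram.  Put \<open>\<gamma>\<^sub>0 = - w0 \<Lambda>\<^sub>i\<close>, the highest weight of the module, and
  \<open>\<gamma>\<^sub>l = \<gamma>\<^sub>l\<^sub>-\<^sub>1 - b\<^sub>l \<alpha>\<^sub>l\<close>, where \<open>\<alpha>\<^sub>l\<close> and \<open>h\<^sub>l\<close> are the simple root and the simple coroot of the
  \<open>l\<close>-th letter.  Then the exponents of the monomial are \<open>d\<^sub>l = \<gamma>\<^sub>l(h\<^sub>l) + b\<^sub>l\<close>, and dividing by \<open>A\<^sub>j\<close>
  subtracts \<open>\<alpha>\<^sub>j\<close> from the \<open>\<gamma>\<^sub>l\<close> with \<open>j \<le> l < j\<^sup>+\<close>.  Suppose that all \<open>\<gamma>\<^sub>l\<close> are weights of the module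
  and that \<open>b \<ge> 0\<close>.  The pairings \<open>\<gamma>\<^sub>l(h\<^sub>t)\<close> lie in \<open>{1, 0, -1}\<close>, so a position either has \<open>b\<^sub>l = 0\<close> and
  \<open>d\<^sub>l = \<gamma>\<^sub>l(h\<^sub>l)\<close>, or has \<open>b\<^sub>l = 1\<close> and \<open>d\<^sub>l = 0\<close>.  If \<open>d\<^sub>j = 1\<close>, then \<open>\<gamma>\<^sub>j(h\<^sub>j) = 1\<close>; subtracting other simple roots
  can only increase the pairing with \<open>h\<^sub>j\<close>, which thus stays equal to 1 up to \<open>j\<^sup>+\<close>.  Hence \<open>d\<^bsub>j+\<^esub> \<noteq> 1\<close> forces
  \<open>b\<^bsub>j+\<^esub> = 1\<close> and \<open>d\<^bsub>j+\<^esub> = 0\<close>: the rules of the two graphs select the same \<open>j\<close> (\<open>bar_cond_iff\<close>).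
  Moreover the move replaces these \<open>\<gamma>\<^sub>l\<close> by their images under a simple reflection, which are again weights,
  so that the hypothesis on the path is inherited (\<open>bar_move\<close>).  The two constructions therefore run in
  parallel, and they stop because a path is determined by \<open>b \<in> {0,1}\<^sup>N\<close> (\<open>DG_bar_eq_DG\<close>).

  It remains to see that the initial vector describes such a path (\<open>initial_vector_path\<close>).  Its weights are
  \<open>\<gamma>\<^sub>l = - s\<^sub>l\<^sub>+\<^sub>1 \<dots> s\<^sub>N \<Lambda>\<^sub>i\<close> for \<open>l < k\<close> and \<open>\<gamma>\<^sub>l = - s\<^sub>l\<^sub>+\<^sub>1 \<dots> s\<^sub>N s\<^sub>i \<Lambda>\<^sub>i\<close> for \<open>l \<ge> k\<close>; they are weights of the module
  because these are closed under simple reflections (\<open>weights_reflection\<close>).  Nonnegativity of the steps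
  comes from the word being reduced: then \<open>s\<^sub>N \<dots> s\<^sub>l\<^sub>+\<^sub>1 \<alpha>\<^sub>l\<close> is a positive root, by the exchange
  argument (\<open>reduced_word_factor_positive\<close>), for \<open>l > k\<close> it stays positive under \<open>s\<^sub>i\<close>
  (\<open>pairing_beyond_crossing\<close>), and the pairing of its coroot with \<open>\<Lambda>\<^sub>i\<close> has the sign of
  its coefficient at \<open>\<alpha>\<^sub>i\<close> (\<open>coroot_of_W_image\<close>, by means of the invariant form obtained by summing over all
  roots).  The root system itself is controlled by the representation theory of \<open>sl\<^sub>2\<close> in the adjoint module.
\<close>

section \<open>Root strings in a finite-dimensional Lie algebra\<close>

context lie_algebra
begin

lemma bracket_add_left: "bracket (x + y) z = bracket x z + bracket y z"
  using bracket_linear_left[of z] by (simp add: Vector_Spaces.linear_iff)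

lemma bracket_add_right: "bracket z (x + y) = bracket z x + bracket z y"
  using bracket_linear_right[of z] by (simp add: Vector_Spaces.linear_iff)

lemma bracket_scale_left: "bracket (scale c x) z = scale c (bracket x z)"
  using bracket_linear_left[of z] by (simp add: Vector_Spaces.linear_iff)

lemma bracket_scale_right: "bracket z (scale c x) = scale c (bracket z x)"
  using bracket_linear_right[of z] by (simp add: Vector_Spaces.linear_iff)

lemma bracket_zero_right [simp]: "bracket x 0 = 0"
  using bracket_scale_right[of x 0 0] by simp

lemma bracket_antisym: "bracket x y = - bracket y x"
proof -
  have "0 = bracket (x + y) (x + y)"
    by (simp only: bracket_self)
  also have "\<dots> = bracket x y + bracket y x"
    by (simp only: bracket_add_left bracket_add_right) (simp add: bracket_self)
  finally show ?thesis
    by (metis eq_neg_iff_add_eq_0)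
qed

lemma bracket_minus_right: "bracket x (- y) = - bracket x y"
  using bracket_scale_right[of x "-1" y] by simp

lemma bracket_derivation: "bracket x (bracket y z) = bracket (bracket x y) z + bracket y (bracket x z)"
proof -
  have "bracket (bracket x y) z = - bracket z (bracket x y)"
    by (rule bracket_antisym)
  moreover have "bracket y (bracket z x) = - bracket y (bracket x z)"
    using bracket_antisym[of z x] by (simp add: bracket_minus_right)
  moreover have "bracket x (bracket y z) = - (bracket y (bracket z x) + bracket z (bracket x y))"
    using jacobi[of x y z] unfolding add.assoc by (rule eq_neg_iff_add_eq_0[THEN iffD2])
  ultimately show ?thesis
    by (simp only: minus_add_distrib minus_minus add.commute)
qed

lemma bracket_sum_right: "bracket x (\<Sum>b\<in>S. f b) = (\<Sum>b\<in>S. bracket x (f b))"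
  by (induction S rule: infinite_finite_induct) (simp_all add: bracket_add_right)

lemma dual_combine:
  assumes "\<beta> \<in> dual H" "\<gamma> \<in> dual H"
  shows "(\<lambda>x. c * \<beta> x + d * \<gamma> x) \<in> dual H"
  using assms by (auto simp: dual_def algebra_simps)

lemma dual_uminus: "\<beta> \<in> dual H \<Longrightarrow> (\<lambda>x. - \<beta> x) \<in> dual H"
  using dual_combine[of \<beta> H \<beta> "-1" 0] by simp

lemma dual_neg:
  assumes "\<beta> \<in> dual H" "x \<in> H"
  shows "\<beta> (- x) = - \<beta> x"
proof -
  have "\<beta> (scale (-1) x) = (-1) * \<beta> x"
    using assms unfolding dual_def by blast
  then show ?thesis by simp
qed

lemma dual_eqI:
  assumes "\<beta> \<in> dual H" "\<gamma> \<in> dual H" "\<And>y. y \<in> H \<Longrightarrow> \<beta> y = \<gamma> y"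
  shows "\<beta> = \<gamma>"
proof
  fix y
  show "\<beta> y = \<gamma> y"
    using assms by (cases "y \<in> H") (auto simp: dual_def)
qed

lemma root_space_bracket:
  assumes "x \<in> root_space H \<beta>" "z \<in> root_space H \<gamma>"
  shows "bracket x z \<in> root_space H (\<lambda>y. \<beta> y + \<gamma> y)"
  using assms unfolding root_space_def
  by (auto simp: bracket_derivation[of _ x z] bracket_scale_left bracket_scale_right scale_left_distrib)

lemma zero_in_root_space: "0 \<in> root_space H \<beta>"
  by (simp add: root_space_def)

text \<open>Simultaneous eigenvectors for pairwise distinct functionals: applying \<open>ad y - \<gamma> y\<close> to a relation
  removes the term of \<open>\<gamma>\<close>, and a suitable \<open>y\<close> separates \<open>\<gamma>\<close> from any other functional.\<close>

lemma root_vectors_independent: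
  assumes "finite S" "S \<subseteq> dual H"
    and "\<And>\<beta>. \<beta> \<in> S \<Longrightarrow> v \<beta> \<in> root_space H \<beta>" "\<And>\<beta>. \<beta> \<in> S \<Longrightarrow> v \<beta> \<noteq> 0"
    and "(\<Sum>\<beta>\<in>S. scale (c \<beta>) (v \<beta>)) = 0"
  shows "\<forall>\<beta>\<in>S. c \<beta> = 0"
  using assms
proof (induction S arbitrary: c rule: finite_induct)
  case empty
  then show ?case by simp
next
  case (insert \<gamma> S)
  have ev: "bracket y (v \<beta>) = scale (\<beta> y) (v \<beta>)" if "\<beta> \<in> insert \<gamma> S" "y \<in> H" for \<beta> y
    using insert.prems(2)[OF that(1)] that(2) by (simp add: root_space_def)
  have diff: "c \<beta> * (\<beta> y - \<gamma> y) = 0" if y: "y \<in> H" and \<beta>: "\<beta> \<in> S" for y \<beta>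
  proof -
    have "0 = bracket y (\<Sum>\<beta>\<in>insert \<gamma> S. scale (c \<beta>) (v \<beta>))
              - scale (\<gamma> y) (\<Sum>\<beta>\<in>insert \<gamma> S. scale (c \<beta>) (v \<beta>))"
      unfolding insert.prems(4) by simp
    also have "\<dots> = (\<Sum>\<beta>\<in>insert \<gamma> S. scale (c \<beta> * (\<beta> y - \<gamma> y)) (v \<beta>))"
      unfolding bracket_sum_right scale_sum_right sum_subtractf[symmetric]
      by (intro sum.cong refl)
        (simp add: bracket_scale_right ev[OF _ y] right_diff_distrib scale_left_diff_distrib mult.commute)
    also have "\<dots> = (\<Sum>\<beta>\<in>S. scale (c \<beta> * (\<beta> y - \<gamma> y)) (v \<beta>))"
      using insert.hyps by simp
    finally show ?thesis
      using insert.IH[of "\<lambda>\<beta>. c \<beta> * (\<beta> y - \<gamma> y)"] insert.prems(1-3) \<beta> by auto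
  qed
  have S0: "c \<beta> = 0" if "\<beta> \<in> S" for \<beta>
  proof -
    have "\<beta> \<noteq> \<gamma>"
      using that insert.hyps by auto
    moreover have "\<beta> \<in> dual H" "\<gamma> \<in> dual H"
      using insert.prems(1) that by auto
    ultimately obtain y where "y \<in> H" "\<beta> y \<noteq> \<gamma> y"
      using dual_eqI by metis
    then show ?thesis
      using diff[of y, OF _ that] by simp
  qed
  then have "scale (c \<gamma>) (v \<gamma>) = 0"
    using insert.prems(4) insert.hyps by simp
  then show ?case
    using S0 insert.prems(3) by auto
qed

text \<open>Finite dimension enters the theory here: this bound gives the finiteness of the set of roots and the
  nilpotency of the root vectors.\<close>

lemma finite_nonzero_root_spaces:
  assumes "finite B" "span B = UNIV"
  shows "finite {\<beta> \<in> dual H. root_space H \<beta> \<noteq> {0}}" (is "finite ?S")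
proof -
  have "\<forall>\<beta>\<in>?S. \<exists>x. x \<in> root_space H \<beta> \<and> x \<noteq> 0"
    using zero_in_root_space by blast
  from bchoice[OF this] obtain v
    where v: "\<forall>\<beta>\<in>?S. v \<beta> \<in> root_space H \<beta> \<and> v \<beta> \<noteq> 0" ..
  have inj: "inj_on v ?S"
  proof (rule inj_onI)
    fix \<beta> \<gamma> assume *: "\<beta> \<in> ?S" "\<gamma> \<in> ?S" "v \<beta> = v \<gamma>"
    have "\<beta> y = \<gamma> y" if "y \<in> H" for y
      using bspec[OF v *(1)] bspec[OF v *(2)] *(3) that by (auto simp: root_space_def)
    then show "\<beta> = \<gamma>"
      using * dual_eqI[of \<beta> H \<gamma>] by auto
  qed
  have "independent (v ` ?S)"
  proof
    assume "dependent (v ` ?S)"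
    then obtain T u x where T: "finite T" "T \<subseteq> v ` ?S" "x \<in> T" "u x \<noteq> 0" "(\<Sum>x\<in>T. scale (u x) x) = 0"
      unfolding dependent_explicit by blast
    obtain S where S: "S \<subseteq> ?S" "T = v ` S"
      using T(2) by (auto simp: subset_image_iff)
    have injS: "inj_on v S"
      using inj S(1) by (rule inj_on_subset)
    have "finite S"
      using T(1) S(2) injS by (simp add: finite_image_iff)
    moreover have "(\<Sum>\<beta>\<in>S. scale (u (v \<beta>)) (v \<beta>)) = 0"
      using T(5) by (simp add: S(2) sum.reindex[OF injS])
    ultimately have "\<forall>\<beta>\<in>S. u (v \<beta>) = 0"
      using v S(1) by (intro root_vectors_independent[of S H v "\<lambda>\<beta>. u (v \<beta>)"]) auto
    then show False
      using T(3,4) S(2) by auto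
  qed
  then have "finite (v ` ?S)"
    using independent_span_bound[OF assms(1)] assms(2) by blast
  then show ?thesis
    using inj by (simp add: finite_image_iff)
qed

definition sl2_triple :: "'g set \<Rightarrow> ('g \<Rightarrow> complex) \<Rightarrow> 'g \<Rightarrow> 'g \<Rightarrow> 'g \<Rightarrow> bool" where
  "sl2_triple H a e f h \<longleftrightarrow> a \<in> dual H \<and> e \<in> root_space H a \<and> f \<in> root_space H (\<lambda>x. - a x)
     \<and> bracket e f = h \<and> h \<in> H \<and> a h = 2"

lemma sl2_triple_swap:
  assumes "subspace H" "sl2_triple H a e f h"
  shows "sl2_triple H (\<lambda>x. - a x) f e (- h)"
proof -
  have "a (- h) = - a h"
    using assms(2) by (intro dual_neg) (auto simp: sl2_triple_def)
  then show ?thesis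
    using assms bracket_antisym[of f e]
    by (auto simp: sl2_triple_def dual_uminus subspace_neg)
qed

lemma lowering_root_space:
  assumes "sl2_triple H a e f h" "y \<in> root_space H \<beta>"
  shows "(bracket f ^^ r) y \<in> root_space H (\<lambda>x. \<beta> x - of_nat r * a x)"
proof (induction r)
  case (Suc r)
  have "f \<in> root_space H (\<lambda>x. - a x)"
    using assms(1) by (simp add: sl2_triple_def)
  then show ?case
    using root_space_bracket[OF _ Suc] by (fastforce simp: algebra_simps)
qed (use assms in simp)

text \<open>The vectors \<open>(ad f)\<^sup>r y\<close> lie in root spaces of pairwise distinct functionals, only finitely many of
  which have a nonzero root space.\<close>

lemma lowering_nilpotent:
  assumes fd: "finite B" "span B = UNIV"
    and sl2: "sl2_triple H a e f h" and \<beta>: "\<beta> \<in> dual H" "y \<in> root_space H \<beta>"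
  shows "\<exists>r. (bracket f ^^ r) y = 0"
proof (rule ccontr)
  assume "\<nexists>r. (bracket f ^^ r) y = 0"
  then have "(\<lambda>x. \<beta> x - of_nat r * a x) \<in> {\<beta> \<in> dual H. root_space H \<beta> \<noteq> {0}}" for r
    using lowering_root_space[OF sl2 \<beta>(2), of r] dual_combine[OF \<beta>(1), of a 1 "- of_nat r"] sl2
    by (auto simp: sl2_triple_def)
  then have "range (\<lambda>r x. \<beta> x - of_nat r * a x) \<subseteq> {\<beta> \<in> dual H. root_space H \<beta> \<noteq> {0}}"
    by blast
  then have "finite (range (\<lambda>(r::nat) x. \<beta> x - of_nat r * a x))"
    using finite_nonzero_root_spaces[OF fd] by (rule finite_subset)
  moreover have "inj (\<lambda>(r::nat) x. \<beta> x - of_nat r * a x)"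
    using sl2 by (auto simp: inj_on_def sl2_triple_def fun_eq_iff dest!: spec[of _ h])
  ultimately show False
    using finite_imageD by auto
qed

text \<open>The commutation rule \<open>e f\<^sup>r\<^sup>+\<^sup>1 y = (r + 1) (q - r) f\<^sup>r y\<close> for a highest weight vector \<open>y\<close> of weight
  \<open>q\<close> over \<open>sl\<^sub>2\<close>.\<close>

lemma raising_of_lowered:
  assumes sl2: "sl2_triple H a e f h" and y: "y \<in> root_space H \<beta>" "bracket e y = 0"
  shows "bracket e ((bracket f ^^ Suc r) y)
         = scale (of_nat (Suc r) * (\<beta> h - of_nat r)) ((bracket f ^^ r) y)"
proof (induction r)
  case 0
  show ?case
    using sl2 y by (simp add: bracket_derivation[of e] sl2_triple_def root_space_def)
next
  case (Suc r)
  let ?z = "(bracket f ^^ Suc r) y"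
  have "bracket e (bracket f ?z) = bracket h ?z + bracket f (bracket e ?z)"
    using sl2 by (simp add: bracket_derivation[of e f] sl2_triple_def)
  also have "bracket h ?z = scale (\<beta> h - of_nat (Suc r) * 2) ?z"
    using lowering_root_space[OF sl2 y(1), of "Suc r"] sl2 by (simp add: root_space_def sl2_triple_def)
  also have "bracket f (bracket e ?z) = scale (of_nat (Suc r) * (\<beta> h - of_nat r)) ?z"
    unfolding Suc by (simp add: bracket_scale_right)
  also have "scale (\<beta> h - of_nat (Suc r) * 2) ?z + scale (of_nat (Suc r) * (\<beta> h - of_nat r)) ?z
      = scale (of_nat (Suc (Suc r)) * (\<beta> h - of_nat (Suc r))) ?z"
    unfolding scale_left_distrib[symmetric] by (simp add: algebra_simps)
  finally show ?case
    by simp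
qed

text \<open>Take the first \<open>r\<close> with \<open>f\<^sup>r y = 0\<close>; by the commutation rule the factor
  \<open>\<beta> h - (r - 1)\<close> vanishes.\<close>

lemma highest_weight_vector:
  assumes fd: "finite B" "span B = UNIV"
    and sl2: "sl2_triple H a e f h"
    and y: "\<beta> \<in> dual H" "y \<in> root_space H \<beta>" "bracket e y = 0" "y \<noteq> 0"
  shows "\<exists>q::nat. \<beta> h = of_nat q \<and> (\<forall>r\<le>q. (bracket f ^^ r) y \<noteq> 0)"
proof -
  define m where "m = (LEAST r. (bracket f ^^ r) y = 0)"
  have m: "(bracket f ^^ m) y = 0"
    unfolding m_def using lowering_nilpotent[OF fd sl2 y(1,2)] by (rule LeastI_ex)
  have less: "(bracket f ^^ r) y \<noteq> 0" if "r < m" for r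
    using not_less_Least that unfolding m_def by blast
  obtain q where q: "m = Suc q"
    using m y(4) by (cases m) auto
  have "scale (of_nat (Suc q) * (\<beta> h - of_nat q)) ((bracket f ^^ q) y) = 0"
    using raising_of_lowered[OF sl2 y(2,3), of q] m q by simp
  then have "\<beta> h = of_nat q"
    using less[of q] q by (simp del: of_nat_Suc)
  then show ?thesis
    using less q by auto
qed

text \<open>Raise a vector of weight \<open>m\<close> by \<open>e\<^sup>p\<close> to a highest weight vector, which has weight \<open>m + 2 p\<close>.
  It survives \<open>m + 2 p\<close> lowerings, in particular the \<open>m + p\<close> that lead to the reflected functional.
  Negative \<open>m\<close> is covered by exchanging \<open>e\<close> and \<open>f\<close>, see \<open>sl2_triple_swap\<close>.\<close>

lemma reflected_root_space:
  assumes fd: "finite B" "span B = UNIV" and H: "subspace H"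
    and sl2: "sl2_triple H a e f h"
    and \<beta>: "\<beta> \<in> dual H" "root_space H \<beta> \<noteq> {0}" "\<beta> h = of_nat m"
  shows "root_space H (\<lambda>x. \<beta> x - \<beta> h * a x) \<noteq> {0}"
proof -
  obtain x where x: "x \<in> root_space H \<beta>" "x \<noteq> 0"
    using \<beta>(2) zero_in_root_space by blast
  note sl2' = sl2_triple_swap[OF H sl2]
  define s where "s = (LEAST r. (bracket e ^^ r) x = 0)"
  have s: "(bracket e ^^ s) x = 0"
    unfolding s_def using lowering_nilpotent[OF fd sl2' \<beta>(1) x(1)] by (rule LeastI_ex)
  obtain p where p: "s = Suc p"
    using s x(2) by (cases s) auto
  define y where "y = (bracket e ^^ p) x"
  have y0: "y \<noteq> 0"
    unfolding y_def using not_less_Least[of p "\<lambda>r. (bracket e ^^ r) x = 0"] p s_def by auto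
  have ey: "bracket e y = 0"
    using s p by (simp add: y_def)
  define \<gamma> where "\<gamma> = (\<lambda>x. \<beta> x + of_nat p * a x)"
  have y\<gamma>: "y \<in> root_space H \<gamma>"
    using lowering_root_space[OF sl2' x(1), of p] by (simp add: y_def \<gamma>_def)
  have \<gamma>: "\<gamma> \<in> dual H"
    using dual_combine[OF \<beta>(1), of a 1] sl2 by (simp add: \<gamma>_def sl2_triple_def)
  obtain q :: nat where q: "\<gamma> h = of_nat q" "\<And>r. r \<le> q \<Longrightarrow> (bracket f ^^ r) y \<noteq> 0"
    using highest_weight_vector[OF fd sl2 \<gamma> y\<gamma> ey y0] by blast
  have "of_nat q = (of_nat (m + 2 * p) :: complex)"
    using q(1) \<beta>(3) sl2 by (simp add: \<gamma>_def sl2_triple_def mult.commute)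
  then have "q = m + 2 * p"
    by (rule of_nat_eq_iff[THEN iffD1])
  then have "(bracket f ^^ (m + p)) y \<noteq> 0"
    using q(2) by simp
  moreover have "(\<lambda>x. \<gamma> x - of_nat (m + p) * a x) = (\<lambda>x. \<beta> x - \<beta> h * a x)"
    by (simp add: \<gamma>_def \<beta>(3) algebra_simps)
  ultimately show ?thesis
    using lowering_root_space[OF sl2 y\<gamma>, of "m + p"] by auto
qed

text \<open>A bracket of opposite root vectors commutes with \<open>H\<close>, so it belongs to \<open>H\<close>, as \<open>H\<close> is its own
  centralizer.\<close>

lemma coroot_sl2_triple:
  assumes "cartan_subalgebra H" "\<alpha> \<in> dual H" "coroot H \<alpha> h"
  obtains e f where "sl2_triple H \<alpha> e f h"
proof -
  obtain e f where ef: "e \<in> root_space H \<alpha>" "f \<in> root_space H (\<lambda>x. - \<alpha> x)" "h = bracket e f" "\<alpha> h = 2"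
    using assms(3) by (auto simp: coroot_def)
  have "h \<in> root_space H (\<lambda>y. \<alpha> y + - \<alpha> y)"
    unfolding ef(3) using ef(1,2) by (rule root_space_bracket)
  then have "\<forall>y\<in>H. bracket h y = 0"
    by (simp add: root_space_def bracket_antisym[of h])
  then have "h \<in> H"
    using assms(1) by (auto simp: cartan_subalgebra_def)
  then show thesis
    using that ef assms(2) by (auto simp: sl2_triple_def)
qed

context
  fixes H :: "'g set" and n :: nat and \<alpha> :: "nat \<Rightarrow> 'g \<Rightarrow> complex" and h :: "nat \<Rightarrow> 'g" and B :: "'g set"
  assumes fd: "finite B" "span B = UNIV"
    and cartan: "cartan_subalgebra H"
    and simple: "simple_roots H n \<alpha>"
    and coroots: "\<forall>j\<in>{1..n}. coroot H (\<alpha> j) (h j)"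
begin

lemma simple_in_roots: "j \<in> {1..n} \<Longrightarrow> \<alpha> j \<in> roots H"
  using simple unfolding simple_roots_def by blast

lemma simple_in_dual: "j \<in> {1..n} \<Longrightarrow> \<alpha> j \<in> dual H"
  using simple_in_roots by (simp add: roots_def)

lemma simple_sl2_triple:
  assumes "j \<in> {1..n}"
  obtains e f where "sl2_triple H (\<alpha> j) e f (h j)"
  using coroot_sl2_triple[OF cartan simple_in_dual[OF assms]] coroots assms by blast

lemma subspace_H: "subspace H"
  using cartan by (simp add: cartan_subalgebra_def)

lemma simple_coroot_diagonal: "j \<in> {1..n} \<Longrightarrow> \<alpha> j (h j) = 2"
  using coroots by (simp add: coroot_def)

lemma root_signed:
  assumes "\<beta> \<in> roots H"
  shows "\<exists>c :: nat \<Rightarrow> nat. \<beta> = (\<lambda>x. \<Sum>i=1..n. of_nat (c i) * \<alpha> i x)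
           \<or> \<beta> = (\<lambda>x. - (\<Sum>i=1..n. of_nat (c i) * \<alpha> i x))"
proof -
  have "\<beta> \<in> positive_roots H n \<alpha> \<union> negative_roots H n \<alpha>"
    using assms simple by (simp add: simple_roots_def)
  then show ?thesis
    by (auto simp: positive_roots_def negative_roots_def)
qed

lemma simple_roots_independent:
  assumes "(\<lambda>x. \<Sum>i=1..n. c i * \<alpha> i x) = (\<lambda>x. 0)" "i \<in> {1..n}"
  shows "c i = 0"
  using simple assms unfolding simple_roots_def by blast

lemma finite_roots: "finite (roots H)"
  using finite_nonzero_root_spaces[OF fd, of H] by (rule finite_subset[rotated]) (auto simp: roots_def)

text \<open>Such a difference has coefficients of both signs, so it is not a root.\<close>

lemma difference_of_simple_roots:
  assumes l: "l \<in> {1..n}" and j: "j \<in> {1..n}" and "l \<noteq> j"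
  shows "root_space H (\<lambda>x. - \<alpha> j x + \<alpha> l x) = {0}"
proof (rule ccontr)
  let ?\<delta> = "\<lambda>i. (if i = l then 1 else 0) - (if i = j then 1 else (0::complex))"
  have \<gamma>: "- \<alpha> j x + \<alpha> l x = (\<Sum>i=1..n. ?\<delta> i * \<alpha> i x)" for x
  proof -
    have "(\<Sum>i=1..n. ?\<delta> i * \<alpha> i x)
        = (\<Sum>i=1..n. if l = i then \<alpha> i x else 0) - (\<Sum>i=1..n. if j = i then \<alpha> i x else 0)"
      unfolding sum_subtractf[symmetric] by (rule sum.cong) auto
    then show ?thesis
      using l j by simp
  qed
  assume nz: "root_space H (\<lambda>x. - \<alpha> j x + \<alpha> l x) \<noteq> {0}"
  have "(\<lambda>x. - \<alpha> j x + \<alpha> l x) \<noteq> (\<lambda>x. 0)"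
  proof
    assume "(\<lambda>x. - \<alpha> j x + \<alpha> l x) = (\<lambda>x. 0)"
    then have "?\<delta> l = 0"
      unfolding \<gamma> using l by (rule simple_roots_independent)
    then show False
      using \<open>l \<noteq> j\<close> by simp
  qed
  moreover have "(\<lambda>x. - \<alpha> j x + \<alpha> l x) \<in> dual H"
    using dual_combine[OF simple_in_dual[OF j] simple_in_dual[OF l], of "-1" 1] by simp
  ultimately have "(\<lambda>x. - \<alpha> j x + \<alpha> l x) \<in> roots H"
    using nz by (simp add: roots_def)
  then obtain c :: "nat \<Rightarrow> nat" where
    "(\<lambda>x. - \<alpha> j x + \<alpha> l x) = (\<lambda>x. \<Sum>i=1..n. of_nat (c i) * \<alpha> i x)
     \<or> (\<lambda>x. - \<alpha> j x + \<alpha> l x) = (\<lambda>x. - (\<Sum>i=1..n. of_nat (c i) * \<alpha> i x))"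
    using root_signed by blast
  then show False
  proof
    assume "(\<lambda>x. - \<alpha> j x + \<alpha> l x) = (\<lambda>x. \<Sum>i=1..n. of_nat (c i) * \<alpha> i x)"
    then have "(\<lambda>x. \<Sum>i=1..n. (of_nat (c i) - ?\<delta> i) * \<alpha> i x) = (\<lambda>x. 0)"
      unfolding \<gamma> by (simp add: fun_eq_iff left_diff_distrib sum_subtractf)
    then have "of_nat (c j) - ?\<delta> j = 0"
      using j by (rule simple_roots_independent[where c = "\<lambda>i. of_nat (c i) - ?\<delta> i"])
    then have "of_nat (Suc (c j)) = (0::complex)"
      using \<open>l \<noteq> j\<close> by (simp add: add.commute)
    then show False
      by (simp only: of_nat_eq_0_iff nat.distinct)
  next
    assume "(\<lambda>x. - \<alpha> j x + \<alpha> l x) = (\<lambda>x. - (\<Sum>i=1..n. of_nat (c i) * \<alpha> i x))"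
    then have "(\<lambda>x. \<Sum>i=1..n. (of_nat (c i) + ?\<delta> i) * \<alpha> i x) = (\<lambda>x. 0)"
      unfolding \<gamma> by (simp add: fun_eq_iff distrib_right sum.distrib)
    then have "of_nat (c l) + ?\<delta> l = 0"
      using l by (rule simple_roots_independent[where c = "\<lambda>i. of_nat (c i) + ?\<delta> i"])
    then have "of_nat (Suc (c l)) = (0::complex)"
      using \<open>l \<noteq> j\<close> by (simp add: add.commute)
    then show False
      by (simp only: of_nat_eq_0_iff nat.distinct)
  qed
qed

text \<open>A root vector of \<open>\<alpha> l\<close> is killed by \<open>f\<close> of the triple of \<open>\<alpha> j\<close>, that is, it is a highest weight
  vector for the swapped triple.\<close>

lemma cartan_off_diagonal:
  assumes l: "l \<in> {1..n}" and j: "j \<in> {1..n}" and "l \<noteq> j"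
  shows "\<exists>q::nat. \<alpha> l (h j) = - of_nat q"
proof -
  obtain e f where sl2: "sl2_triple H (\<alpha> j) e f (h j)"
    using simple_sl2_triple[OF j] .
  note swapped = sl2_triple_swap[OF subspace_H sl2]
  obtain x where x: "x \<in> root_space H (\<alpha> l)" "x \<noteq> 0"
    using simple_in_roots[OF l] zero_in_root_space[of H "\<alpha> l"] unfolding roots_def by blast
  have "bracket f x \<in> root_space H (\<lambda>y. - \<alpha> j y + \<alpha> l y)"
    using sl2 by (intro root_space_bracket x) (simp add: sl2_triple_def)
  then have "bracket f x = 0"
    using difference_of_simple_roots[OF assms] by simp
  then obtain q :: nat where "\<alpha> l (- h j) = of_nat q"
    using highest_weight_vector[OF fd swapped simple_in_dual[OF l] x(1) _ x(2)] by blast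
  moreover have "\<alpha> l (- h j) = - \<alpha> l (h j)"
    using dual_neg[OF simple_in_dual[OF l]] sl2 by (simp add: sl2_triple_def)
  ultimately show ?thesis
    by (intro exI[of _ q]) (metis minus_minus)
qed

lemma cartan_integral:
  assumes "l \<in> {1..n}" "j \<in> {1..n}"
  shows "\<alpha> l (h j) \<in> \<int>"
  using cartan_off_diagonal[OF assms] simple_coroot_diagonal[OF assms(2)] by (cases "l = j") auto

lemma root_reflection:
  assumes \<beta>: "\<beta> \<in> roots H" and j: "j \<in> {1..n}"
  shows "simple_reflection h \<alpha> j \<beta> \<in> roots H"
proof -
  obtain e f where sl2: "sl2_triple H (\<alpha> j) e f (h j)"
    using simple_sl2_triple[OF j] .
  note swapped = sl2_triple_swap[OF subspace_H sl2]
  have \<beta>': "\<beta> \<in> dual H" "\<beta> \<noteq> (\<lambda>x. 0)" "root_space H \<beta> \<noteq> {0}"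
    using \<beta> by (auto simp: roots_def)
  have sum_int: "(\<Sum>i=1..n. of_nat (c i) * \<alpha> i (h j)) \<in> \<int>" for c :: "nat \<Rightarrow> nat"
    using j by (intro Ints_sum Ints_mult cartan_integral) auto
  have "\<beta> (h j) \<in> \<int>"
    using root_signed[OF \<beta>] sum_int by (auto simp del: Ints_sum)
  then obtain z where z: "\<beta> (h j) = of_int z"
    by (auto elim: Ints_cases)
  have neg: "\<beta> (- h j) = - \<beta> (h j)"
    using dual_neg[OF \<beta>'(1)] sl2 by (simp add: sl2_triple_def)
  have "root_space H (\<lambda>x. \<beta> x - \<beta> (h j) * \<alpha> j x) \<noteq> {0}"
  proof (cases "z \<ge> 0")
    case True
    then have "\<beta> (h j) = of_nat (nat z)"
      using z by simp
    then show ?thesis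
      by (rule reflected_root_space[OF fd subspace_H sl2 \<beta>'(1,3)])
  next
    case False
    then have "\<beta> (- h j) = of_nat (nat (- z))"
      using z neg by simp
    then have "root_space H (\<lambda>x. \<beta> x - \<beta> (- h j) * - \<alpha> j x) \<noteq> {0}"
      by (rule reflected_root_space[OF fd subspace_H swapped \<beta>'(1,3)])
    then show ?thesis
      by (simp add: neg)
  qed
  moreover have "(\<lambda>x. \<beta> x - \<beta> (h j) * \<alpha> j x) \<in> dual H"
    using dual_combine[OF \<beta>'(1) simple_in_dual[OF j], of 1 "- \<beta> (h j)"] by simp
  moreover have "(\<lambda>x. \<beta> x - \<beta> (h j) * \<alpha> j x) \<noteq> (\<lambda>x. 0)"
  proof
    assume 0: "(\<lambda>x. \<beta> x - \<beta> (h j) * \<alpha> j x) = (\<lambda>x. 0)"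
    then have "\<beta> (h j) - \<beta> (h j) * 2 = 0"
      using fun_cong[OF 0, of "h j"] simple_coroot_diagonal[OF j] by simp
    then have "\<beta> (h j) = 0"
      by simp
    then show False
      using 0 \<beta>'(2) by simp
  qed
  ultimately show ?thesis
    by (simp add: roots_def simple_reflection_def)
qed

end

end

section \<open>Reflecting the weights of a minuscule module\<close>

context lie_module
begin

lemma act_weight_space:
  assumes "x \<in> root_space H \<beta>" "v \<in> weight_space H \<mu>"
  shows "act x v \<in> weight_space H (\<lambda>y. \<mu> y + \<beta> y)"
proof -
  have s: "act (scale c x) v = scaleV c (act x v)" for c x v
    using act_linear_left[of v] by (simp add: Vector_Spaces.linear_iff)
  have s': "act x (scaleV c v) = scaleV c (act x v)" for c x v
    using act_linear_right[of x] by (simp add: Vector_Spaces.linear_iff)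
  show ?thesis
    using assms unfolding weight_space_def root_space_def
    by (auto simp: V.scale_left_distrib)
      (metis (no_types) s s' act_bracket add.commute diff_add_cancel)
qed

lemma act_zero: "act x 0 = 0"
proof -
  have "\<forall>c v. act x (scaleV c v) = scaleV c (act x v)"
    using act_linear_right[of x] by (simp add: Vector_Spaces.linear_iff)
  from this[rule_format, of 0 0] show ?thesis by simp
qed

lemma act_bracket_weight:
  assumes "sl2_triple H a e f h" "v \<in> weight_space H \<mu>"
  shows "act e (act f v) - act f (act e v) = scaleV (\<mu> h) v"
  using assms act_bracket[of e f v] by (simp add: sl2_triple_def weight_space_def)

text \<open>Let \<open>\<mu> h = 1\<close> and let \<open>v\<close> be a weight vector.
  If \<open>f v = 0\<close>, then \<open>- f (e v) = v\<close> gives \<open>e v \<noteq> 0\<close>, and \<open>\<mu> + a\<close> is a weight whose pairing with \<open>h\<close> is 3.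
  So \<open>f v\<close> is a weight vector for the reflected weight.  The case \<open>\<mu> h = -1\<close> is symmetric, and \<open>\<mu> h = 0\<close> means that \<open>\<mu>\<close> is fixed.\<close>

lemma weights_reflection:
  assumes sl2: "sl2_triple H a e f h"
    and minuscule: "\<And>\<mu>. \<mu> \<in> weights H \<Longrightarrow> \<mu> h \<in> {1, 0, -1}"
    and \<mu>: "\<mu> \<in> weights H"
  shows "(\<lambda>x. \<mu> x - \<mu> h * a x) \<in> weights H"
proof -
  have d: "(\<lambda>x. \<mu> x + c * a x) \<in> dual H" for c
    using dual_combine[of \<mu> H a 1 c] \<mu> sl2 by (simp add: weights_def sl2_triple_def)
  obtain v where v: "v \<in> weight_space H \<mu>" "v \<noteq> 0"
  proof -
    have "0 \<in> weight_space H \<mu>" by (simp add: weight_space_def act_zero)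
    then show ?thesis using \<mu> that by (auto simp: weights_def)
  qed
  have ev: "act e v \<in> weight_space H (\<lambda>x. \<mu> x + 1 * a x)"
    using act_weight_space[OF _ v(1), of e a] sl2 by (simp add: sl2_triple_def)
  have fv: "act f v \<in> weight_space H (\<lambda>x. \<mu> x + (-1) * a x)"
    using act_weight_space[OF _ v(1), of f "\<lambda>x. - a x"] sl2 by (simp add: sl2_triple_def)
  have ah: "a h = 2"
    using sl2 by (simp add: sl2_triple_def)
  have up: "(\<lambda>x. \<mu> x + 1 * a x) \<in> weights H" if "act e v \<noteq> 0"
    using ev that d unfolding weights_def by blast
  have down: "(\<lambda>x. \<mu> x + (-1) * a x) \<in> weights H" if "act f v \<noteq> 0"
    using fv that d unfolding weights_def by blast
  have br: "act e (act f v) - act f (act e v) = scaleV (\<mu> h) v"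
    using act_bracket_weight[OF sl2 v(1)] .
  consider "\<mu> h = 0" | "\<mu> h = 1" | "\<mu> h = -1"
    using minuscule[OF \<mu>] by auto
  then show ?thesis
  proof cases
    case 1
    then show ?thesis using \<mu> by simp
  next
    case 2
    have "act f v \<noteq> 0"
    proof
      assume 0: "act f v = 0"
      then have "act e v \<noteq> 0"
        using br 2 v(2) by (auto simp: act_zero)
      then show False
        using minuscule[OF up] 2 ah by auto
    qed
    then show ?thesis using down 2 by simp
  next
    case 3
    have "act e v \<noteq> 0"
    proof
      assume 0: "act e v = 0"
      then have "act f v \<noteq> 0"
        using br 3 v(2) by (auto simp: act_zero)
      then show False
        using minuscule[OF down] 3 ah by auto
    qed
    then show ?thesis using up 3 by simp
  qed
qed

end

section \<open>Root systems with a base: coroots and reduced words\<close>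

lemma weyl_word_Nil: "weyl_word h \<alpha> [] \<mu> = \<mu>"
  by (simp add: weyl_word_def)

lemma weyl_word_Cons: "weyl_word h \<alpha> (j # js) \<mu> = simple_reflection h \<alpha> j (weyl_word h \<alpha> js \<mu>)"
  by (simp add: weyl_word_def)

lemma weyl_word_append: "weyl_word h \<alpha> (js @ ks) \<mu> = weyl_word h \<alpha> js (weyl_word h \<alpha> ks \<mu>)"
  by (induction js) (simp_all add: weyl_word_Nil weyl_word_Cons)

lemma weyl_word_combine:
  "weyl_word h \<alpha> js (\<lambda>x. \<mu> x + c * \<nu> x) = (\<lambda>x. weyl_word h \<alpha> js \<mu> x + c * weyl_word h \<alpha> js \<nu> x)"
  by (induction js) (simp_all add: weyl_word_Nil weyl_word_Cons simple_reflection_def algebra_simps)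

lemma Ints_imp_Reals: "z \<in> \<int> \<Longrightarrow> z \<in> (\<real> :: complex set)"
  by (auto elim!: Ints_cases)

lemma simple_reflection_involution:
  "\<alpha> j (h j) = 2 \<Longrightarrow> simple_reflection h \<alpha> j (simple_reflection h \<alpha> j \<mu>) = \<mu>"
  by (simp add: simple_reflection_def fun_eq_iff algebra_simps)

text \<open>The properties of the roots of the Lie algebra, in the role of \<open>R\<close>, on which the exchange argument rests.\<close>

locale based_root_system =
  fixes n :: nat and h :: "nat \<Rightarrow> 'g" and \<alpha> :: "nat \<Rightarrow> 'g \<Rightarrow> complex"
    and R :: "('g \<Rightarrow> complex) set" and \<Lambda> :: "nat \<Rightarrow> 'g \<Rightarrow> complex"
  assumes diagonal: "j \<in> {1..n} \<Longrightarrow> \<alpha> j (h j) = 2"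
    and integral: "l \<in> {1..n} \<Longrightarrow> j \<in> {1..n} \<Longrightarrow> \<alpha> l (h j) \<in> \<int>"
    and finite_R: "finite R"
    and simple_in_R: "j \<in> {1..n} \<Longrightarrow> \<alpha> j \<in> R"
    and reflection_in_R: "\<beta> \<in> R \<Longrightarrow> j \<in> {1..n} \<Longrightarrow> simple_reflection h \<alpha> j \<beta> \<in> R"
    and signed: "\<beta> \<in> R \<Longrightarrow> \<exists>c :: nat \<Rightarrow> nat. \<beta> = (\<lambda>x. \<Sum>i=1..n. of_nat (c i) * \<alpha> i x)
                    \<or> \<beta> = (\<lambda>x. - (\<Sum>i=1..n. of_nat (c i) * \<alpha> i x))"
    and simple_independent: "(\<lambda>x. \<Sum>i=1..n. c i * \<alpha> i x) = (\<lambda>x. 0) \<Longrightarrow> i \<in> {1..n} \<Longrightarrow> c i = 0"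
    and \<Lambda>_span: "i \<in> {1..n} \<Longrightarrow> \<exists>c. \<Lambda> i = (\<lambda>x. \<Sum>j=1..n. c j * \<alpha> j x)"
    and \<Lambda>_coroot: "i \<in> {1..n} \<Longrightarrow> j \<in> {1..n} \<Longrightarrow> \<Lambda> i (h j) = (if i = j then 1 else 0)"
begin

abbreviation s where "s \<equiv> simple_reflection h \<alpha>"
abbreviation W where "W \<equiv> weyl_word h \<alpha>"

definition positive :: "('g \<Rightarrow> complex) \<Rightarrow> bool" where
  "positive \<beta> \<longleftrightarrow> (\<exists>c :: nat \<Rightarrow> nat. \<beta> = (\<lambda>x. \<Sum>i=1..n. of_nat (c i) * \<alpha> i x))"

lemma s_involution: "j \<in> {1..n} \<Longrightarrow> s j (s j \<mu>) = \<mu>"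
  by (intro simple_reflection_involution diagonal)

lemma W_rev_cancel: "set js \<subseteq> {1..n} \<Longrightarrow> W js (W (rev js) \<mu>) = \<mu>"
  by (induction js arbitrary: \<mu>) (simp_all add: weyl_word_Nil weyl_word_Cons weyl_word_append s_involution)

lemma W_rev_cancel': "set js \<subseteq> {1..n} \<Longrightarrow> W (rev js) (W js \<mu>) = \<mu>"
  using W_rev_cancel[of "rev js"] by simp

lemma W_in_R: "\<beta> \<in> R \<Longrightarrow> set js \<subseteq> {1..n} \<Longrightarrow> W js \<beta> \<in> R"
  by (induction js) (simp_all add: weyl_word_Nil weyl_word_Cons reflection_in_R)

lemma W_fixes_coroot_kernel:
  assumes "\<And>j. j \<in> {1..n} \<Longrightarrow> \<mu> (h j) = 0" "set js \<subseteq> {1..n}"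
  shows "W js \<mu> = \<mu>"
  using assms(2) by (induction js) (simp_all add: weyl_word_Nil weyl_word_Cons simple_reflection_def assms(1))

lemma W_integral:
  assumes "\<And>j. j \<in> {1..n} \<Longrightarrow> \<mu> (h j) \<in> \<int>" "set js \<subseteq> {1..n}" "j \<in> {1..n}"
  shows "W js \<mu> (h j) \<in> \<int>"
  using assms(2,3)
  by (induction js arbitrary: j) (simp_all add: weyl_word_Nil weyl_word_Cons simple_reflection_def assms(1) integral)

lemma root_integral:
  assumes "\<beta> \<in> R" "j \<in> {1..n}"
  shows "\<beta> (h j) \<in> \<int>"
proof -
  obtain c :: "nat \<Rightarrow> nat" where "\<beta> (h j) = (\<Sum>i=1..n. of_nat (c i) * \<alpha> i (h j))
      \<or> \<beta> (h j) = - (\<Sum>i=1..n. of_nat (c i) * \<alpha> i (h j))"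
    using signed[OF assms(1)] by auto
  moreover have "(\<Sum>i=1..n. of_nat (c i) * \<alpha> i (h j)) \<in> \<int>"
    using assms(2) by (intro Ints_sum Ints_mult integral) auto
  ultimately show ?thesis by auto
qed

text \<open>The squared length of \<open>h j\<close> for the Weyl-invariant form \<open>(x, y) = (\<Sum>\<beta>\<in>R. \<beta> x * \<beta> y)\<close>.  Real parts keep the
  value in the ordered field; the summands are squares of integers.\<close>

definition norm2 :: "nat \<Rightarrow> real" where
  "norm2 j = (\<Sum>\<beta>\<in>R. (Re (\<beta> (h j)))\<^sup>2)"

lemma norm2_complex: "j \<in> {1..n} \<Longrightarrow> complex_of_real (norm2 j) = (\<Sum>\<beta>\<in>R. (\<beta> (h j))\<^sup>2)"
  unfolding norm2_def of_real_sum of_real_power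
proof (intro sum.cong refl)
  fix \<beta> assume "\<beta> \<in> R" "j \<in> {1..n}"
  then have "\<beta> (h j) \<in> \<real>"
    using root_integral Ints_imp_Reals by blast
  then show "(complex_of_real (Re (\<beta> (h j))))\<^sup>2 = (\<beta> (h j))\<^sup>2"
    by simp
qed

lemma norm2_pos:
  assumes "j \<in> {1..n}"
  shows "norm2 j > 0"
  unfolding norm2_def
  by (rule sum_pos2[of _ "\<alpha> j"]) (simp_all add: finite_R simple_in_R[OF assms] diagonal[OF assms])

text \<open>Elements of the Cartan subalgebra appear as linear forms on functions, such as
  \<open>\<lambda>\<mu>. \<mu> (h j)\<close>.  The Weyl group acts on functions, so its action on coroots is by composition.\<close>

definition linear_form :: "(('g \<Rightarrow> complex) \<Rightarrow> complex) \<Rightarrow> bool" where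
  "linear_form y \<longleftrightarrow> (\<forall>\<mu> \<nu> c. y (\<lambda>x. \<mu> x + c * \<nu> x) = y \<mu> + c * y \<nu>)"

lemma linear_form_sum:
  assumes "linear_form y" "finite A"
  shows "y (\<lambda>x. \<Sum>i\<in>A. c i * f i x) = (\<Sum>i\<in>A. c i * y (f i))"
  using assms(2)
proof (induction A rule: finite_induct)
  case empty
  have "y (\<lambda>x. 0 + (-1) * 0) = y (\<lambda>x. 0) + (-1) * y (\<lambda>x. 0)"
    using assms(1)[unfolded linear_form_def, rule_format, of "\<lambda>x. 0" "-1" "\<lambda>x. 0"] .
  then show ?case by simp
next
  case (insert a A)
  have "(\<lambda>x. \<Sum>i\<in>insert a A. c i * f i x) = (\<lambda>x. (\<Sum>i\<in>A. c i * f i x) + c a * f a x)"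
    using insert.hyps by (simp add: add.commute)
  then show ?case
    using insert assms(1) by (simp add: linear_form_def)
qed

lemma sum_over_roots_W:
  assumes "set js \<subseteq> {1..n}"
  shows "(\<Sum>\<beta>\<in>R. g (W js \<beta>)) = (\<Sum>\<beta>\<in>R. g \<beta>)"
  by (rule sum.reindex_bij_witness[of _ "W (rev js)" "W js"])
    (use assms in \<open>auto simp: W_rev_cancel W_rev_cancel' W_in_R\<close>)

text \<open>The sum over \<open>R\<close> is invariant under \<open>s j\<close>, which negates \<open>\<beta> (h j)\<close>: with respect to the invariant
  form, \<open>\<alpha> j\<close> is the functional \<open>2 (h j, \<cdot>) / (h j, h j)\<close>.\<close>

lemma pairing_with_coroot:
  assumes "linear_form y" "j \<in> {1..n}"
  shows "(\<Sum>\<beta>\<in>R. \<beta> (h j) * y \<beta>) = complex_of_real (norm2 j) / 2 * y (\<alpha> j)"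
proof -
  have y: "y (s j \<beta>) = y \<beta> - \<beta> (h j) * y (\<alpha> j)" for \<beta> :: "'g \<Rightarrow> complex"
    using assms(1)[unfolded linear_form_def, rule_format, of \<beta> "- \<beta> (h j)" "\<alpha> j"]
    by (simp add: simple_reflection_def)
  have "(\<Sum>\<beta>\<in>R. \<beta> (h j) * y \<beta>) = (\<Sum>\<beta>\<in>R. s j \<beta> (h j) * y (s j \<beta>))"
    using sum_over_roots_W[of "[j]" "\<lambda>\<beta>. \<beta> (h j) * y \<beta>"] assms(2)
    by (simp add: weyl_word_Nil weyl_word_Cons)
  also have "\<dots> = (\<Sum>\<beta>\<in>R. (\<beta> (h j))\<^sup>2 * y (\<alpha> j) - \<beta> (h j) * y \<beta>)"
  proof (rule sum.cong)
    fix \<beta> :: "'g \<Rightarrow> complex"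
    have "s j \<beta> (h j) = - \<beta> (h j)"
      by (simp add: simple_reflection_def diagonal[OF assms(2)])
    then show "s j \<beta> (h j) * y (s j \<beta>) = (\<beta> (h j))\<^sup>2 * y (\<alpha> j) - \<beta> (h j) * y \<beta>"
      unfolding y by (simp add: power2_eq_square algebra_simps)
  qed simp
  also have "\<dots> = complex_of_real (norm2 j) * y (\<alpha> j) - (\<Sum>\<beta>\<in>R. \<beta> (h j) * y \<beta>)"
    by (simp add: sum_subtractf norm2_complex[OF assms(2)] sum_distrib_right)
  finally show ?thesis
    by (simp add: algebra_simps)
qed

text \<open>If \<open>\<beta> = W js (\<alpha> j) = \<Sum> p\<^sub>l \<alpha>\<^sub>l\<close>, then the coroot of \<open>\<beta>\<close> is \<open>\<Sum> p\<^sub>l (|h j|\<^sup>2 / |h l|\<^sup>2) h l\<close>: both sides have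
  the same product with everything under the invariant form.  The difference \<open>z\<close> of both
  sides is real on \<open>R\<close> and orthogonal to itself, so it vanishes on \<open>R\<close>, hence on the \<open>\<Lambda>\<close>'s.  An arbitrary \<open>\<mu>\<close>
  agrees on the simple coroots with a combination of \<open>\<Lambda>\<close>'s, and \<open>W\<close> does not move the difference.\<close>

lemma coroot_of_W_image:
  fixes p :: "nat \<Rightarrow> real"
  assumes js: "set js \<subseteq> {1..n}" and j: "j \<in> {1..n}"
    and p: "W js (\<alpha> j) = (\<lambda>x. \<Sum>l=1..n. complex_of_real (p l) * \<alpha> l x)"
  shows "W (rev js) \<mu> (h j) = (\<Sum>l=1..n. complex_of_real (p l * norm2 j / norm2 l) * \<mu> (h l))"
proof -
  define z :: "('g \<Rightarrow> complex) \<Rightarrow> complex" where "z = (\<lambda>\<mu>. W (rev js) \<mu> (h j) - (\<Sum>l=1..n. complex_of_real (p l * norm2 j / norm2 l) * \<mu> (h l)))"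
  have lin_z: "linear_form z"
    unfolding linear_form_def z_def weyl_word_combine
    by (simp only: distrib_left sum.distrib sum_distrib_left right_diff_distrib mult.left_commute) simp
  have orthogonal: "(\<Sum>\<beta>\<in>R. z \<beta> * y \<beta>) = 0" if y: "linear_form y" for y
  proof -
    have yW: "linear_form (\<lambda>\<mu>. y (W js \<mu>))"
      using y by (simp add: linear_form_def weyl_word_combine)
    have "(\<Sum>\<beta>\<in>R. W (rev js) \<beta> (h j) * y \<beta>) = (\<Sum>\<beta>\<in>R. \<beta> (h j) * y (W js \<beta>))"
      using sum_over_roots_W[OF js, of "\<lambda>\<beta>. W (rev js) \<beta> (h j) * y \<beta>"] by (simp add: W_rev_cancel'[OF js])
    also have "\<dots> = complex_of_real (norm2 j) / 2 * y (W js (\<alpha> j))"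
      by (rule pairing_with_coroot[OF yW j])
    also have "\<dots> = complex_of_real (norm2 j) / 2 * (\<Sum>l=1..n. complex_of_real (p l) * y (\<alpha> l))"
      unfolding p using linear_form_sum[OF y, of "{1..n}" "\<lambda>l. complex_of_real (p l)" \<alpha>] by simp
    also have "\<dots> = (\<Sum>l=1..n. complex_of_real (p l * norm2 j / norm2 l) * (complex_of_real (norm2 l) / 2 * y (\<alpha> l)))"
      unfolding sum_distrib_left
    proof (rule sum.cong)
      fix l assume "l \<in> {1..n}"
      then have "norm2 l \<noteq> 0"
        using norm2_pos by (metis less_irrefl)
      then show "complex_of_real (norm2 j) / 2 * (complex_of_real (p l) * y (\<alpha> l))
          = complex_of_real (p l * norm2 j / norm2 l) * (complex_of_real (norm2 l) / 2 * y (\<alpha> l))"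
        by (simp add: field_simps)
    qed simp
    also have "\<dots> = (\<Sum>l=1..n. complex_of_real (p l * norm2 j / norm2 l) * (\<Sum>\<beta>\<in>R. \<beta> (h l) * y \<beta>))"
      by (rule sum.cong) (simp_all add: pairing_with_coroot[OF y])
    also have "\<dots> = (\<Sum>\<beta>\<in>R. (\<Sum>l=1..n. complex_of_real (p l * norm2 j / norm2 l) * \<beta> (h l)) * y \<beta>)"
      unfolding sum_distrib_left sum_distrib_right
      by (subst sum.swap) (simp add: mult.assoc)
    finally show ?thesis
      by (simp add: z_def left_diff_distrib sum_subtractf)
  qed
  have z_real: "z \<beta> \<in> \<real>" if "\<beta> \<in> R" for \<beta>
  proof -
    have "W (rev js) \<beta> (h j) \<in> \<int>"
      using js that j by (intro root_integral W_in_R) auto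
    moreover have "\<beta> (h l) \<in> \<real>" if "l \<in> {1..n}" for l
      using root_integral[OF \<open>\<beta> \<in> R\<close> that] by (rule Ints_imp_Reals)
    ultimately show ?thesis
      unfolding z_def
      by (intro Reals_diff sum_in_Reals Reals_mult Reals_of_real) (auto intro: Ints_imp_Reals)
  qed
  have z_root: "z \<beta> = 0" if "\<beta> \<in> R" for \<beta>
  proof -
    have "complex_of_real (\<Sum>\<beta>\<in>R. (Re (z \<beta>))\<^sup>2) = (\<Sum>\<beta>\<in>R. z \<beta> * z \<beta>)"
      unfolding of_real_sum
      by (rule sum.cong) (use z_real in \<open>auto simp: power2_eq_square elim!: Reals_cases\<close>)
    then have "(\<Sum>\<beta>\<in>R. (Re (z \<beta>))\<^sup>2) = 0"
      unfolding orthogonal[OF lin_z] by (simp only: of_real_eq_0_iff)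
    then have "Re (z \<beta>) = 0"
      using that finite_R by (simp add: sum_nonneg_eq_0_iff)
    then show ?thesis
      using z_real[OF that] by (auto elim!: Reals_cases)
  qed
  have z_\<Lambda>: "z (\<Lambda> i) = 0" if i: "i \<in> {1..n}" for i
  proof -
    obtain c where "\<Lambda> i = (\<lambda>x. \<Sum>j=1..n. c j * \<alpha> j x)"
      using \<Lambda>_span[OF i] by blast
    then show ?thesis
      using linear_form_sum[OF lin_z, of "{1..n}" c \<alpha>] by (simp add: z_root simple_in_R)
  qed
  define \<mu>' where "\<mu>' = (\<lambda>x. \<Sum>i=1..n. \<mu> (h i) * \<Lambda> i x)"
  have \<mu>': "\<mu>' (h i) = \<mu> (h i)" if "i \<in> {1..n}" for i
  proof -
    have "\<mu>' (h i) = (\<Sum>l=1..n. if i = l then \<mu> (h l) else 0)"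
      unfolding \<mu>'_def by (rule sum.cong) (use that in \<open>auto simp: \<Lambda>_coroot\<close>)
    then show ?thesis
      using that by simp
  qed
  have "z \<mu>' = 0"
    unfolding \<mu>'_def using linear_form_sum[OF lin_z, of "{1..n}" "\<lambda>i. \<mu> (h i)" \<Lambda>] by (simp add: z_\<Lambda>)
  moreover have "W (rev js) \<mu> (h j) = W (rev js) \<mu>' (h j)"
  proof -
    have "W (rev js) (\<lambda>x. \<mu> x + (-1) * \<mu>' x) = (\<lambda>x. \<mu> x + (-1) * \<mu>' x)"
      by (rule W_fixes_coroot_kernel) (use \<mu>' js in auto)
    then have "W (rev js) \<mu> (h j) + (-1) * W (rev js) \<mu>' (h j) = \<mu> (h j) + (-1) * \<mu>' (h j)"
      unfolding weyl_word_combine by meson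
    then show ?thesis
      using \<mu>'[OF j] by simp
  qed
  ultimately show ?thesis
    by (simp add: z_def \<mu>')
qed

lemma coefficients_unique:
  assumes "(\<lambda>x. \<Sum>l=1..n. c l * \<alpha> l x) = (\<lambda>x. \<Sum>l=1..n. d l * \<alpha> l x)" "i \<in> {1..n}"
  shows "c i = d i"
proof -
  have "(\<lambda>x. \<Sum>l=1..n. (c l - d l) * \<alpha> l x) = (\<lambda>x. 0)"
    using assms(1) by (simp add: fun_eq_iff left_diff_distrib sum_subtractf)
  then have "c i - d i = 0"
    using assms(2) by (rule simple_independent[of "\<lambda>l. c l - d l"])
  then show ?thesis by simp
qed

lemma simple_as_sum:
  assumes "j \<in> {1..n}"
  shows "\<alpha> j = (\<lambda>x. \<Sum>l=1..n. (if l = j then 1 else 0) * \<alpha> l x)"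
proof
  fix x
  have "(\<Sum>l=1..n. (if l = j then 1 else 0) * \<alpha> l x) = (\<Sum>l=1..n. if j = l then \<alpha> l x else 0)"
    by (rule sum.cong) auto
  then show "\<alpha> j x = (\<Sum>l=1..n. (if l = j then 1 else 0) * \<alpha> l x)"
    using assms by simp
qed

lemma positive_simple: "j \<in> {1..n} \<Longrightarrow> positive (\<alpha> j)"
  unfolding positive_def using simple_as_sum[of j]
  by (intro exI[of _ "\<lambda>l. if l = j then 1 else 0"]) (simp add: if_distrib cong: if_cong)

lemma not_positive_uminus_simple:
  assumes "j \<in> {1..n}"
  shows "\<not> positive (\<lambda>x. - \<alpha> j x)"
proof
  assume "positive (\<lambda>x. - \<alpha> j x)"
  then obtain c :: "nat \<Rightarrow> nat" where c: "(\<lambda>x. - \<alpha> j x) = (\<lambda>x. \<Sum>l=1..n. of_nat (c l) * \<alpha> l x)"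
    unfolding positive_def by blast
  have "(\<lambda>x. \<Sum>l=1..n. - of_nat (c l) * \<alpha> l x) = \<alpha> j"
    using c by (simp add: sum_negf fun_eq_iff) (metis minus_minus)
  then have "(\<lambda>x. \<Sum>l=1..n. - of_nat (c l) * \<alpha> l x) = (\<lambda>x. \<Sum>l=1..n. (if l = j then 1 else 0) * \<alpha> l x)"
    using simple_as_sum[OF assms] by simp
  then have "- of_nat (c j) = (if j = j then 1 else (0::complex))"
    using assms by (rule coefficients_unique[of "\<lambda>l. - of_nat (c l)"])
  then have "of_nat (Suc (c j)) = (0::complex)"
    by (simp add: neg_eq_iff_add_eq_0 add.commute)
  then show False
    by (simp only: of_nat_eq_0_iff nat.distinct)
qed

text \<open>A simple reflection changes only one coefficient, so if it turns a positive root into a negative one,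
  this root is \<open>p \<alpha> m\<close>.  Then its coroot is \<open>z (h m)\<close> with \<open>z\<close> an integer, and \<open>p z = 1\<close> because root and
  coroot pair to 2.\<close>

lemma positive_reflection:
  assumes js: "set js \<subseteq> {1..n}" and j: "j \<in> {1..n}" and m: "m \<in> {1..n}"
    and pos: "positive (W js (\<alpha> j))" and neg: "\<not> positive (s m (W js (\<alpha> j)))"
  shows "W js (\<alpha> j) = \<alpha> m"
proof -
  let ?\<beta> = "W js (\<alpha> j)"
  obtain p :: "nat \<Rightarrow> nat" where p: "?\<beta> = (\<lambda>x. \<Sum>l=1..n. of_nat (p l) * \<alpha> l x)"
    using pos unfolding positive_def by blast
  have "s m ?\<beta> \<in> R"
    by (intro reflection_in_R W_in_R simple_in_R js j m)
  then obtain q :: "nat \<Rightarrow> nat" where q: "s m ?\<beta> = (\<lambda>x. - (\<Sum>l=1..n. of_nat (q l) * \<alpha> l x))"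
    using signed neg unfolding positive_def by blast
  have zero: "p l = 0" if l: "l \<in> {1..n}" "l \<noteq> m" for l
  proof -
    have "(\<lambda>x. \<Sum>l=1..n. of_nat (p l + q l) * \<alpha> l x)
        = (\<lambda>x. \<Sum>l=1..n. (?\<beta> (h m) * (if l = m then 1 else 0)) * \<alpha> l x)"
    proof
      fix x
      have "(\<Sum>l=1..n. of_nat (p l + q l) * \<alpha> l x) = ?\<beta> x - s m ?\<beta> x"
        unfolding q by (subst p) (simp add: algebra_simps sum.distrib)
      also have "\<dots> = ?\<beta> (h m) * \<alpha> m x"
        by (simp add: simple_reflection_def)
      also have "\<dots> = (\<Sum>l=1..n. (?\<beta> (h m) * (if l = m then 1 else 0)) * \<alpha> l x)"
        by (subst simple_as_sum[OF m]) (simp add: sum_distrib_left mult.assoc)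
      finally show "(\<Sum>l=1..n. of_nat (p l + q l) * \<alpha> l x)
          = (\<Sum>l=1..n. (?\<beta> (h m) * (if l = m then 1 else 0)) * \<alpha> l x)" .
    qed
    then have "(of_nat (p l + q l) :: complex) = ?\<beta> (h m) * (if l = m then 1 else 0)"
      using l(1) by (rule coefficients_unique[of "\<lambda>l. of_nat (p l + q l)"])
    then show ?thesis
      using l(2) by (simp del: of_nat_add)
  qed
  have collapse: "(\<Sum>l=1..n. of_nat (p l) * f l) = of_nat (p m) * f m" for f :: "nat \<Rightarrow> complex"
  proof -
    have "(\<Sum>l=1..n. of_nat (p l) * f l) = (\<Sum>l=1..n. if m = l then of_nat (p l) * f l else 0)"
      by (rule sum.cong) (auto simp: zero)
    then show ?thesis using m by simp
  qed
  have \<beta>: "?\<beta> = (\<lambda>x. of_nat (p m) * \<alpha> m x)"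
    by (subst p) (simp only: collapse)
  have coroot: "W (rev js) \<mu> (h j) = of_nat (p m) * (complex_of_real (norm2 j / norm2 m) * \<mu> (h m))" for \<mu>
  proof -
    have "W (rev js) \<mu> (h j)
        = (\<Sum>l=1..n. of_nat (p l) * (complex_of_real (norm2 j / norm2 l) * \<mu> (h l)))"
      using coroot_of_W_image[OF js j, of "\<lambda>l. real (p l)" \<mu>] p by (simp add: mult.assoc)
    also have "\<dots> = of_nat (p m) * (complex_of_real (norm2 j / norm2 m) * \<mu> (h m))"
      by (rule collapse)
    finally show ?thesis .
  qed
  have "W (rev js) (\<Lambda> m) (h j) \<in> \<int>"
    by (rule W_integral) (use js j m in \<open>auto simp: \<Lambda>_coroot\<close>)
  then obtain z where z: "of_nat (p m) * complex_of_real (norm2 j / norm2 m) = (of_int z :: complex)"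
    using coroot[of "\<Lambda> m"] m by (auto simp: \<Lambda>_coroot elim!: Ints_cases)
  have "2 = W (rev js) ?\<beta> (h j)"
    by (simp add: W_rev_cancel'[OF js] diagonal[OF j])
  also have "\<dots> = of_nat (p m) * complex_of_real (norm2 j / norm2 m) * (of_nat (p m) * 2)"
    by (simp add: coroot) (simp add: \<beta> diagonal[OF m])
  also have "\<dots> = of_int (z * int (p m)) * 2"
    unfolding z by simp
  finally have "of_int (z * int (p m)) = (1 :: complex)"
    by simp
  then have "z * int (p m) = 1"
    by (simp only: of_int_eq_1_iff)
  then have "p m = 1"
    by (simp add: zmult_eq_1_iff)
  then show ?thesis
    by (simp add: \<beta>)
qed

lemma coroot_transport:
  assumes js: "set js \<subseteq> {1..n}" and j: "j \<in> {1..n}" and m: "m \<in> {1..n}" and eq: "W js (\<alpha> j) = \<alpha> m"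
  shows "W (rev js) \<mu> (h j) = \<mu> (h m)"
proof -
  have collapse: "(\<Sum>l=1..n. (if l = m then 1 else 0) * f l) = f m" for f :: "nat \<Rightarrow> complex"
  proof -
    have "(\<Sum>l=1..n. (if l = m then 1 else 0) * f l) = (\<Sum>l=1..n. if m = l then f l else 0)"
      by (rule sum.cong) auto
    then show ?thesis using m by simp
  qed
  have "W js (\<alpha> j) = (\<lambda>x. \<Sum>l=1..n. complex_of_real (if l = m then 1 else 0) * \<alpha> l x)"
    unfolding eq using simple_as_sum[OF m] by (simp add: if_distrib cong: if_cong)
  from coroot_of_W_image[OF js j this]
  have coroot: "W (rev js) \<nu> (h j) = complex_of_real (norm2 j / norm2 m) * \<nu> (h m)" for \<nu>
    using collapse[of "\<lambda>l. complex_of_real (norm2 j / norm2 l) * \<nu> (h l)"] m by (simp add: if_distrib if_distribR cong: if_cong)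
  have "2 = W (rev js) (\<alpha> m) (h j)"
    by (simp add: eq[symmetric] W_rev_cancel'[OF js] diagonal[OF j])
  also have "\<dots> = complex_of_real (norm2 j / norm2 m) * 2"
    by (simp add: coroot diagonal[OF m])
  finally have "complex_of_real (norm2 j / norm2 m) = 1"
    by (simp del: of_real_divide)
  then show ?thesis
    using coroot[of \<mu>] by simp
qed

lemma conjugate_reflection:
  assumes js: "set js \<subseteq> {1..n}" and j: "j \<in> {1..n}" and m: "m \<in> {1..n}" and eq: "W js (\<alpha> j) = \<alpha> m"
  shows "W js (s j (W (rev js) \<mu>)) = s m \<mu>"
proof -
  have "W js (s j (W (rev js) \<mu>)) = W js (\<lambda>x. W (rev js) \<mu> x + (- \<mu> (h m)) * \<alpha> j x)"
    by (simp add: simple_reflection_def coroot_transport[OF assms])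
  also have "\<dots> = s m \<mu>"
    unfolding weyl_word_combine by (simp add: W_rev_cancel[OF js] eq simple_reflection_def)
  finally show ?thesis .
qed

lemma negative_image_crosses_simple_root:
  assumes "set js \<subseteq> {1..n}" "j \<in> {1..n}" "\<not> positive (W js (\<alpha> j))"
  shows "\<exists>js1 m js2. js = js1 @ m # js2 \<and> W js2 (\<alpha> j) = \<alpha> m"
  using assms
proof (induction js)
  case Nil
  then show ?case
    using positive_simple by (simp add: weyl_word_Nil)
next
  case (Cons m js)
  show ?case
  proof (cases "positive (W js (\<alpha> j))")
    case True
    then have "W js (\<alpha> j) = \<alpha> m"
      using Cons.prems by (intro positive_reflection) (auto simp: weyl_word_Cons)
    then show ?thesis
      by (intro exI[of _ "[]"]) auto
  next
    case False
    then obtain js1 m' js2 where "js = js1 @ m' # js2" "W js2 (\<alpha> j) = \<alpha> m'"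
      using Cons by auto
    then show ?thesis
      by (intro exI[of _ "m # js1"]) auto
  qed
qed

text \<open>The exchange argument.  Just before the image of \<open>\<alpha> j\<close> turns negative, it equals the simple root \<open>\<alpha> m\<close> of the
  letter applied next; conjugating the reflection of \<open>j\<close> to that of \<open>m\<close> allows both letters to be deleted from the word.\<close>

lemma reduced_word_factor_positive:
  assumes red: "reduced_word h \<alpha> n ii w" and ii: "ii = pre @ j # us @ post"
  shows "positive (W (rev us) (\<alpha> j))"
proof (rule ccontr)
  assume neg: "\<not> positive (W (rev us) (\<alpha> j))"
  have I: "set ii \<subseteq> {1..n}" and w: "W ii = w" and len: "length ii = weyl_length h \<alpha> n w"
    using red by (auto simp: reduced_word_def)
  have j: "j \<in> {1..n}" and us: "set (rev us) \<subseteq> {1..n}"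
    using I ii by auto
  obtain js1 m js2 where js: "rev us = js1 @ m # js2" and eq: "W js2 (\<alpha> j) = \<alpha> m"
    using negative_image_crosses_simple_root[OF us j neg] by blast
  have us_eq: "us = rev js2 @ m # rev js1"
    using arg_cong[OF js, of rev] by simp
  have m: "m \<in> {1..n}" and js2: "set js2 \<subseteq> {1..n}"
    using us js by auto
  have cancel: "s j (W (rev js2) (s m \<mu>)) = W (rev js2) \<mu>" for \<mu>
  proof -
    have "W js2 (s j (W (rev js2) (s m \<mu>))) = \<mu>"
      using conjugate_reflection[OF js2 j m eq, of "s m \<mu>"] by (simp add: s_involution[OF m])
    then show ?thesis
      using W_rev_cancel'[OF js2, of "s j (W (rev js2) (s m \<mu>))"] by simp
  qed
  \<comment> \<open>the word without the letters \<open>j\<close> and \<open>m\<close>\<close>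
  define ii' where "ii' = pre @ rev js2 @ rev js1 @ post"
  have "W ii' = w"
    unfolding w[symmetric] ii us_eq ii'_def
    by (rule ext) (simp add: weyl_word_append weyl_word_Cons cancel)
  moreover have "set ii' \<subseteq> {1..n}"
    using I ii us_eq by (auto simp: ii'_def)
  ultimately have "weyl_length h \<alpha> n w \<le> length ii'"
    unfolding weyl_length_def by (intro Least_le) auto
  then show False
    using len ii us_eq by (simp add: ii'_def)
qed

lemma positive_coroot_pairing:
  assumes js: "set js \<subseteq> {1..n}" and j: "j \<in> {1..n}" and i: "i \<in> {1..n}"
    and pos: "positive (W (rev js) (\<alpha> j))"
  shows "\<exists>r\<ge>0. W js (\<Lambda> i) (h j) = complex_of_real r"
proof -
  obtain p :: "nat \<Rightarrow> nat" where p: "W (rev js) (\<alpha> j) = (\<lambda>x. \<Sum>l=1..n. of_nat (p l) * \<alpha> l x)"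
    using pos unfolding positive_def by blast
  have "W js (\<Lambda> i) (h j) = (\<Sum>l=1..n. complex_of_real (p l * norm2 j / norm2 l) * \<Lambda> i (h l))"
    using coroot_of_W_image[of "rev js" j "\<lambda>l. real (p l)" "\<Lambda> i"] js j p by simp
  also have "\<dots> = (\<Sum>l=1..n. if i = l then complex_of_real (p l * norm2 j / norm2 l) else 0)"
    by (rule sum.cong) (use i in \<open>auto simp: \<Lambda>_coroot\<close>)
  also have "\<dots> = complex_of_real (p i * norm2 j / norm2 i)"
    using i by simp
  finally show ?thesis
    using norm2_pos[OF i] norm2_pos[OF j] by (intro exI[of _ "p i * norm2 j / norm2 i"]) simp
qed

text \<open>Beyond the position of \<open>c\<close> the root to be considered is \<open>s i\<close> applied to the positive root
  \<open>W (rev us) (\<alpha> j)\<close>.  It is negative only if the latter is \<open>\<alpha> i\<close>; but \<open>\<alpha> i\<close> already arises from the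
  letter \<open>c\<close>, and a coincidence would make the image of \<open>\<alpha> c\<close> under the intermediate letters negative.\<close>

lemma pairing_beyond_crossing:
  assumes red: "reduced_word h \<alpha> n ii w" and ii: "ii = pre @ c # vs @ j # us"
    and i: "i \<in> {1..n}" and k: "W (rev (vs @ j # us)) (\<alpha> c) = \<alpha> i"
  shows "\<exists>r\<ge>0. W (us @ [i]) (\<Lambda> i) (h j) = complex_of_real r"
proof -
  have I: "set ii \<subseteq> {1..n}"
    using red by (simp add: reduced_word_def)
  then have j: "j \<in> {1..n}" and us: "set us \<subseteq> {1..n}"
    using ii by auto
  have "positive (W (rev us) (\<alpha> j))"
    using reduced_word_factor_positive[OF red, of "pre @ c # vs" j us "[]"] ii by simp
  moreover have "W (rev us) (\<alpha> j) \<noteq> \<alpha> i"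
  proof
    assume "W (rev us) (\<alpha> j) = \<alpha> i"
    also have "\<dots> = W (rev us) (s j (W (rev vs) (\<alpha> c)))"
      by (simp add: k[symmetric] weyl_word_append weyl_word_Cons weyl_word_Nil)
    finally have "W us (W (rev us) (\<alpha> j)) = W us (W (rev us) (s j (W (rev vs) (\<alpha> c))))"
      by simp
    then have "s j (\<alpha> j) = s j (s j (W (rev vs) (\<alpha> c)))"
      by (simp add: W_rev_cancel[OF us])
    then have "W (rev vs) (\<alpha> c) = (\<lambda>x. - \<alpha> j x)"
      by (simp add: s_involution[OF j]) (simp add: simple_reflection_def diagonal[OF j])
    then show False
      using reduced_word_factor_positive[OF red, of pre c vs "j # us"] ii
        not_positive_uminus_simple[OF j] by simp
  qed
  ultimately have "positive (s i (W (rev us) (\<alpha> j)))"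
    using positive_reflection[of "rev us" j i] us i j by auto
  then show ?thesis
    using us i j by (intro positive_coroot_pairing) (simp_all add: weyl_word_Cons)
qed

end

section \<open>Paths of minuscule weights and the two graphs\<close>

lemma int_val_of_int [simp]: "int_val (of_int z) = z"
  by (simp add: int_val_def)

lemma next_pos_properties:
  assumes "next_pos ii j \<le> length ii"
  shows "j < next_pos ii j" "letter ii (next_pos ii j) = letter ii j"
    "\<And>l. j < l \<Longrightarrow> l < next_pos ii j \<Longrightarrow> 1 \<le> l \<Longrightarrow> letter ii l \<noteq> letter ii j"
proof -
  let ?A = "{l \<in> {1..length ii}. letter ii l = letter ii j \<and> l > j}"
  have "next_pos ii j \<in> ?A \<union> {length ii + 1}"
    unfolding next_pos_def by (rule Min_in) auto
  then have "next_pos ii j \<in> ?A"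
    using assms by auto
  then show "j < next_pos ii j" "letter ii (next_pos ii j) = letter ii j"
    by auto
  fix l assume l: "j < l" "l < next_pos ii j" "1 \<le> l"
  show "letter ii l \<noteq> letter ii j"
  proof
    assume "letter ii l = letter ii j"
    then have "l \<in> ?A \<union> {length ii + 1}"
      using l assms by auto
    then have "next_pos ii j \<le> l"
      unfolding next_pos_def by (intro Min_le) auto
    then show False using l by simp
  qed
qed

text \<open>\<open>X\<close> stands for the weights of the minuscule module and \<open>\<nu>\<close> for the start of the paths.\<close>

locale minuscule_paths =
  fixes n :: nat and h :: "nat \<Rightarrow> 'g" and \<alpha> :: "nat \<Rightarrow> 'g \<Rightarrow> complex"
    and X :: "('g \<Rightarrow> complex) set" and \<nu> :: "'g \<Rightarrow> complex" and ii :: "nat list"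
  assumes diagonal: "j \<in> {1..n} \<Longrightarrow> \<alpha> j (h j) = 2"
    and off_diagonal: "l \<in> {1..n} \<Longrightarrow> j \<in> {1..n} \<Longrightarrow> l \<noteq> j \<Longrightarrow> \<exists>q::nat. \<alpha> l (h j) = - of_nat q"
    and letters: "set ii \<subseteq> {1..n}"
    and minuscule: "\<mu> \<in> X \<Longrightarrow> t \<in> {1..n} \<Longrightarrow> \<mu> (h t) \<in> {1, 0, -1}"
    and reflection_closed: "\<mu> \<in> X \<Longrightarrow> t \<in> {1..n} \<Longrightarrow> simple_reflection h \<alpha> t \<mu> \<in> X"
begin

definition path :: "(nat \<Rightarrow> int) \<Rightarrow> nat \<Rightarrow> 'g \<Rightarrow> complex" where
  "path b l = (\<lambda>x. \<nu> x - (\<Sum>m=1..l. of_int (b m) * \<alpha> (letter ii m) x))"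

definition path_monomial :: "(nat \<Rightarrow> int) \<Rightarrow> monomial" where
  "path_monomial b = (\<lambda>l. if l \<in> {1..length ii} then int_val (path b l (h (letter ii l))) + b l else 0)"

definition admissible :: "(nat \<Rightarrow> int) \<Rightarrow> bool" where
  "admissible b \<longleftrightarrow> (\<forall>l\<le>length ii. path b l \<in> X) \<and> (\<forall>l. b l \<ge> 0) \<and> (\<forall>l. l \<notin> {1..length ii} \<longrightarrow> b l = 0)"

lemma letter_in: "l \<in> {1..length ii} \<Longrightarrow> letter ii l \<in> {1..n}"
  using letters nth_mem[of "l - 1" ii] by (fastforce simp: letter_def)

lemma path_Suc: "path b (Suc l) x = path b l x - of_int (b (Suc l)) * \<alpha> (letter ii (Suc l)) x"
  by (simp add: path_def)

lemma path_value:
  assumes "admissible b" "l \<le> length ii" "t \<in> {1..n}"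
  obtains v :: int where "path b l (h t) = of_int v" "v \<in> {1, 0, -1}"
proof -
  have "path b l (h t) \<in> {1, 0, -1}"
    using assms by (intro minuscule) (auto simp: admissible_def)
  then have "path b l (h t) = of_int 1 \<or> path b l (h t) = of_int 0 \<or> path b l (h t) = of_int (-1)"
    by auto
  then show thesis
    using that by blast
qed

text \<open>Across a step the pairing with the coroot of the letter drops by \<open>2 b\<^sub>l\<close>, inside \<open>{1, 0, -1}\<close>.\<close>

lemma step_cases:
  assumes adm: "admissible b" and l: "l \<in> {1..length ii}"
  obtains (stay) "b l = 0" "path b l (h (letter ii l)) = of_int (path_monomial b l)"
      "path b (l - 1) (h (letter ii l)) = of_int (path_monomial b l)" "path_monomial b l \<in> {1, 0, -1}"
    | (descend) "b l = 1" "path_monomial b l = 0"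
      "path b (l - 1) (h (letter ii l)) = 1" "path b l (h (letter ii l)) = -1"
proof -
  let ?t = "letter ii l"
  have t: "?t \<in> {1..n}"
    using letter_in[OF l] .
  obtain v :: int where v: "path b l (h ?t) = of_int v" "v \<in> {1, 0, -1}"
    using path_value[OF adm _ t] l by auto
  obtain u :: int where u: "path b (l - 1) (h ?t) = of_int u" "u \<in> {1, 0, -1}"
  proof -
    have "l - 1 \<le> length ii"
      using l by auto
    then show ?thesis
      using path_value[OF adm _ t] that by blast
  qed
  have "(of_int v :: complex) = of_int u - of_int (b l) * 2"
    using path_Suc[of b "l - 1" "h ?t"] l u(1) v(1) diagonal[OF t] by simp
  also have "\<dots> = of_int (u - b l * 2)"
    by simp
  finally have "v = u - b l * 2"
    by (simp only: of_int_eq_iff)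
  moreover have "b l \<ge> 0"
    using adm by (simp add: admissible_def)
  moreover have "path_monomial b l = v + b l"
    using l v(1) by (simp add: path_monomial_def)
  ultimately have "b l = 0 \<and> u = v \<and> path_monomial b l = v
      \<or> b l = 1 \<and> path_monomial b l = 0 \<and> u = 1 \<and> v = -1"
    using u(2) v(2) unfolding insert_iff empty_iff by arith
  then consider "b l = 0" "u = v" "path_monomial b l = v"
    | "b l = 1" "path_monomial b l = 0" "u = 1" "v = -1"
    by blast
  then show thesis
  proof cases
    case 1
    then show thesis using stay u v by simp
  next
    case 2
    then show thesis using descend u v by simp
  qed
qed

text \<open>Between two occurrences of a letter only other simple roots are subtracted, with coefficients
  \<open>\<ge> 0\<close>; as \<open>a\<^sub>t\<^sub>,\<^sub>u \<le> 0\<close> for \<open>t \<noteq> u\<close>, the pairing cannot decrease, and it is at most 1.\<close>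

lemma path_stays_at_one:
  assumes adm: "admissible b" and j: "j \<in> {1..length ii}" and j': "next_pos ii j \<le> length ii"
    and one: "path_monomial b j = 1" and l: "j \<le> l" "l < next_pos ii j"
  shows "path b l (h (letter ii j)) = 1"
  using l
proof (induction l rule: dec_induct)
  case base
  show ?case
    by (rule step_cases[OF adm j]) (simp_all add: one)
next
  case (step m)
  let ?t = "letter ii j" and ?u = "letter ii (Suc m)"
  have t: "?t \<in> {1..n}" and u: "?u \<in> {1..n}"
    using letter_in[OF j] letter_in[of "Suc m"] j step j' by auto
  have "?u \<noteq> ?t"
    using next_pos_properties(3)[OF j', of "Suc m"] step by auto
  then obtain q :: nat where q: "\<alpha> ?u (h ?t) = - of_nat q"
    using off_diagonal[OF u t] by blast
  obtain v :: int where v: "path b (Suc m) (h ?t) = of_int v" "v \<in> {1, 0, -1}"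
    using path_value[OF adm _ t, of "Suc m"] step j' by auto
  have "(of_int v :: complex) = of_int (1 + b (Suc m) * int q)"
    using path_Suc[of b m "h ?t"] step q v(1) by simp
  then have "v = 1 + b (Suc m) * int q"
    by (simp only: of_int_eq_iff)
  moreover have "b (Suc m) * int q \<ge> 0"
    using adm by (simp add: admissible_def)
  ultimately have "v = 1"
    using v(2) by auto
  then show ?case
    using v(1) by simp
qed

text \<open>From left to right, \<open>b\<^bsub>j+\<^esub> > 0\<close> makes the exponent at \<open>j\<^sup>+\<close> equal to 0.  From right to left, the path
  arrives at \<open>j\<^sup>+\<close> with pairing 1, so it either stays, which gives the exponent 1, or descends.\<close>

lemma bar_cond_iff:
  assumes adm: "admissible b" and j: "j \<in> {1..length ii}" and j': "next_pos ii j \<le> length ii"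
  shows "bar_cond ii (path_monomial b) b j
     \<longleftrightarrow> path_monomial b j = 1 \<and> path_monomial b (next_pos ii j) \<noteq> 1" (is "?L \<longleftrightarrow> ?R")
proof -
  let ?j' = "next_pos ii j" and ?M = "path_monomial b"
  have j'_in: "?j' \<in> {1..length ii}"
    using next_pos_properties(1)[OF j'] j' by auto
  show ?thesis
  proof
    assume ?L
    then have M: "?M j > 0" and b: "b ?j' > 0"
      by (auto simp: bar_cond_def Let_def)
    have "?M j = 1"
      using M by (cases rule: step_cases[OF adm j]) auto
    moreover have "?M ?j' = 0"
      using b by (cases rule: step_cases[OF adm j'_in]) auto
    ultimately show ?R by simp
  next
    assume ?R
    then have M: "?M j = 1" "?M ?j' \<noteq> 1"
      by auto
    have "j \<le> ?j' - 1" "?j' - 1 < ?j'"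
      using next_pos_properties(1)[OF j'] by auto
    then have before: "path b (?j' - 1) (h (letter ii ?j')) = 1"
      using path_stays_at_one[OF adm j j' M(1)] next_pos_properties(2)[OF j'] by simp
    have "b ?j' = 1 \<and> ?M ?j' = 0"
    proof (rule step_cases[OF adm j'_in])
      assume "path b (?j' - 1) (h (letter ii ?j')) = of_int (?M ?j')"
      then have "?M ?j' = 1"
        unfolding before by (metis of_int_1 of_int_eq_iff)
      then show ?thesis using M(2) by simp
    qed auto
    then show ?L
      using M(1) by (simp add: bar_cond_def Let_def)
  qed
qed

lemma path_bar_vector:
  assumes "1 \<le> j" "j < next_pos ii j" "letter ii (next_pos ii j) = letter ii j"
  shows "path (bar_vector ii b j) l x
    = path b l x - (if j \<le> l \<and> l < next_pos ii j then \<alpha> (letter ii j) x else 0)"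
  using assms
  by (induction l)
    (auto simp: path_Suc bar_vector_def algebra_simps, auto simp: path_def)

text \<open>On the positions \<open>j \<le> l < j\<^sup>+\<close> the path pairs to 1 with the coroot of the letter, so that subtracting the simple root is the
  same as reflecting; this is why the path stays inside \<open>X\<close>.\<close>

lemma bar_move:
  assumes adm: "admissible b" and j: "j \<in> {1..length ii}" and j': "next_pos ii j \<le> length ii"
    and cond: "bar_cond ii (path_monomial b) b j"
  shows "admissible (bar_vector ii b j)"
    and "path_monomial (bar_vector ii b j) = div_A (cartan_entry h \<alpha>) ii (path_monomial b) j"
proof -
  let ?j' = "next_pos ii j" and ?b = "bar_vector ii b j" and ?M = "path_monomial b" and ?t = "letter ii j"
  note nxt = next_pos_properties[OF j']
  have t: "?t \<in> {1..n}"
    using letter_in[OF j] .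
  have Mj: "?M j = 1"
    using cond bar_cond_iff[OF adm j j'] by simp
  have bj': "b ?j' > 0"
    using cond by (simp add: bar_cond_def Let_def)
  have path': "path ?b l x = path b l x - (if j \<le> l \<and> l < ?j' then \<alpha> ?t x else 0)" for l x
    using path_bar_vector[of j b l x] j nxt(1,2) by simp
  have path_X: "path ?b l \<in> X" if l: "l \<le> length ii" for l
  proof (cases "j \<le> l \<and> l < ?j'")
    case True
    then have "path ?b l = simple_reflection h \<alpha> ?t (path b l)"
      using path_stays_at_one[OF adm j j' Mj, of l] by (simp add: fun_eq_iff path' simple_reflection_def)
    then show ?thesis
      using adm l reflection_closed[OF _ t] by (simp add: admissible_def)
  next
    case False
    then have "path ?b l = path b l"
      by (auto simp: fun_eq_iff path')
    then show ?thesis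
      using adm l by (simp add: admissible_def)
  qed
  have "?b l \<ge> 0" for l
    using adm bj' by (auto simp: admissible_def bar_vector_def)
  moreover have "?b l = 0" if "l \<notin> {1..length ii}" for l
    using adm that j j' nxt(1) by (auto simp: admissible_def bar_vector_def)
  ultimately show adm': "admissible ?b"
    using path_X by (auto simp: admissible_def)
  show "path_monomial ?b = div_A (cartan_entry h \<alpha>) ii ?M j"
  proof
    fix l
    show "path_monomial ?b l = div_A (cartan_entry h \<alpha>) ii ?M j l"
    proof (cases "l \<in> {1..length ii}")
      case False
      then show ?thesis
        using j j' nxt(1) by (auto simp: path_monomial_def div_A_def A_mono_def)
    next
      case True
      let ?u = "letter ii l"
      have u: "?u \<in> {1..n}"
        using letter_in[OF True] .
      obtain v :: int where v: "path b l (h ?u) = of_int v"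
        using path_value[OF adm _ u, of l] True by auto
      obtain v' :: int where v': "path ?b l (h ?u) = of_int v'"
        using path_value[OF adm' _ u, of l] True by auto
      have M: "?M l = v + b l" and M': "path_monomial ?b l = v' + ?b l"
        using True v v' by (simp_all add: path_monomial_def)
      have diff: "(of_int (v - v') :: complex) = (if j \<le> l \<and> l < ?j' then \<alpha> ?t (h ?u) else 0)"
        using path'[of l "h ?u"] v v' by simp
      consider "l = j" | "l = ?j'" | "j < l" "l < ?j'" | "l < j \<or> ?j' < l"
        by linarith
      then show ?thesis
      proof cases
        case 1
        then have "(of_int (v - v') :: complex) = of_int 2"
          using diff nxt(1) diagonal[OF t] by simp
        then have "v - v' = 2"
          by (simp only: of_int_eq_iff)
        then show ?thesis
          using 1 M M' nxt(1) by (simp add: div_A_def A_mono_def bar_vector_def)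
      next
        case 2
        then have "v = v'"
          using diff by simp
        then show ?thesis
          using 2 M M' nxt(1) by (simp add: div_A_def A_mono_def bar_vector_def)
      next
        case 3
        then have "\<alpha> ?t (h ?u) = of_int (v - v')"
          using diff by simp
        then have "cartan_entry h \<alpha> ?u ?t = v - v'"
          unfolding cartan_entry_def by (simp only: int_val_of_int)
        then show ?thesis
          using 3 M M' by (simp add: div_A_def A_mono_def bar_vector_def)
      next
        case 4
        then have "v = v'"
          using diff nxt(1) by auto
        then show ?thesis
          using 4 M M' nxt(1) by (auto simp: div_A_def A_mono_def bar_vector_def)
      qed
    qed
  qed
qed

lemma finite_admissible: "finite {b. admissible b}"
proof (rule finite_subset)
  show "finite {b :: nat \<Rightarrow> int. \<forall>l. (l \<in> {1..length ii} \<longrightarrow> b l \<in> {0, 1}) \<and> (l \<notin> {1..length ii} \<longrightarrow> b l = 0)}"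
    by (rule finite_set_of_finite_funs) auto
  show "{b. admissible b} \<subseteq> {b. \<forall>l. (l \<in> {1..length ii} \<longrightarrow> b l \<in> {0, 1}) \<and> (l \<notin> {1..length ii} \<longrightarrow> b l = 0)}"
  proof (intro subsetI CollectI allI conjI impI)
    fix b l assume "b \<in> {b. admissible b}" and l: "l \<in> {1..length ii}"
    then have adm: "admissible b"
      by simp
    show "b l \<in> {0, 1}"
      by (rule step_cases[OF adm l]) simp_all
  next
    fix b l assume "b \<in> {b. admissible b}" "l \<notin> {1..length ii}"
    then show "b l = 0"
      by (simp add: admissible_def)
  qed
qed

abbreviation vertices :: "monomial set" where
  "vertices \<equiv> path_monomial ` {b. admissible b}"

text \<open>The invariant of the construction of \<open>DG_bar\<close>.  The bound on the arrows is for termination.\<close>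

definition valid_state :: "assoc_graph \<Rightarrow> bool" where
  "valid_state S \<longleftrightarrow> (\<forall>(M, b)\<in>snd S. admissible b \<and> M = path_monomial b)
     \<and> fst (fst S) = fst ` snd S \<and> snd (fst S) \<subseteq> vertices \<times> vertices"

text \<open>Whichever vector a vertex carries, by \<open>bar_cond_iff\<close> the moves that it allows depend on the monomial
  alone.\<close>

lemma DG_moves_eq:
  assumes "valid_state S"
  shows "DG_moves ii (fst S) = (\<lambda>(M, b, j). (M, j)) ` bar_moves ii S"
proof -
  have cond: "bar_cond ii M b j \<longleftrightarrow> M j = 1 \<and> M (next_pos ii j) \<noteq> 1"
    if "(M, b) \<in> snd S" "j \<in> {1..length ii}" "next_pos ii j \<le> length ii" for M b j
    using assms that bar_cond_iff[of b j] by (auto simp: valid_state_def)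
  have label: "\<exists>b. (M, b) \<in> snd S" if "M \<in> sinks (fst S)" for M
    using assms that by (force simp: valid_state_def sinks_def)
  show ?thesis
  proof (intro equalityI subsetI)
    fix p assume "p \<in> DG_moves ii (fst S)"
    then obtain M j where p: "p = (M, j)" "M \<in> sinks (fst S)" "j \<in> {1..length ii}"
        "next_pos ii j \<le> length ii" "M j = 1 \<and> M (next_pos ii j) \<noteq> 1"
      by (auto simp: DG_moves_def)
    obtain b where b: "(M, b) \<in> snd S"
      using label[OF p(2)] by blast
    have "(M, b, j) \<in> bar_moves ii S"
      using p b cond[OF b p(3,4)] by (simp add: bar_moves_def)
    then show "p \<in> (\<lambda>(M, b, j). (M, j)) ` bar_moves ii S"
      using p(1) by force
  next
    fix p assume "p \<in> (\<lambda>(M, b, j). (M, j)) ` bar_moves ii S"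
    then obtain M b j where p: "p = (M, j)" "(M, b, j) \<in> bar_moves ii S"
      by auto
    then show "p \<in> DG_moves ii (fst S)"
      using cond[of M b j] by (simp add: bar_moves_def DG_moves_def)
  qed
qed

lemma fst_bar_step:
  assumes "valid_state S"
  shows "fst (bar_step a ii S) = DG_step a ii (fst S)"
  unfolding bar_step_def DG_step_def DG_moves_eq[OF assms] image_image
  by (simp add: case_prod_unfold)

lemma bar_step_valid:
  assumes valid: "valid_state S"
  shows "valid_state (bar_step (cartan_entry h \<alpha>) ii S)"
proof -
  let ?a = "cartan_entry h \<alpha>"
  have move: "admissible b \<and> M = path_monomial b \<and> admissible (bar_vector ii b j)
      \<and> div_A ?a ii M j = path_monomial (bar_vector ii b j)"
    if "(M, b, j) \<in> bar_moves ii S" for M b j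
  proof -
    have "admissible b" "M = path_monomial b"
      using valid that by (auto simp: valid_state_def bar_moves_def)
    then show ?thesis
      using that bar_move[of b j] by (simp add: bar_moves_def)
  qed
  have "\<forall>(M, b)\<in>snd (bar_step ?a ii S). admissible b \<and> M = path_monomial b"
    using valid move by (fastforce simp: valid_state_def bar_step_def)
  moreover have "fst (fst (bar_step ?a ii S)) = fst ` snd (bar_step ?a ii S)"
    using valid by (simp add: valid_state_def bar_step_def image_Un image_image case_prod_unfold)
  moreover have "snd (fst (bar_step ?a ii S)) \<subseteq> vertices \<times> vertices"
  proof
    fix e assume "e \<in> snd (fst (bar_step ?a ii S))"
    then consider "e \<in> snd (fst S)"
      | M b j where "(M, b, j) \<in> bar_moves ii S" "e = (M, div_A ?a ii M j)"
      by (auto simp: bar_step_def)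
    then show "e \<in> vertices \<times> vertices"
    proof cases
      case 1
      then show ?thesis using valid by (auto simp: valid_state_def)
    next
      case 2
      then show ?thesis using move[OF 2(1)] by auto
    qed
  qed
  ultimately show ?thesis
    by (simp add: valid_state_def)
qed

text \<open>A move starts at a sink, so its arrow is new.\<close>

lemma bar_step_adds_arrow:
  assumes valid: "valid_state S" and "bar_moves ii S \<noteq> {}"
  shows "card (vertices \<times> vertices) - card (snd (fst (bar_step (cartan_entry h \<alpha>) ii S)))
    < card (vertices \<times> vertices) - card (snd (fst S))"
proof -
  let ?E = "snd (fst S)" and ?E' = "snd (fst (bar_step (cartan_entry h \<alpha>) ii S))"
  obtain M b j where m: "(M, b, j) \<in> bar_moves ii S"
    using assms(2) by auto
  have fin: "finite (vertices \<times> vertices)"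
    using finite_admissible by simp
  have E': "?E' \<subseteq> vertices \<times> vertices"
    using bar_step_valid[OF valid] by (simp add: valid_state_def)
  have "?E \<subseteq> ?E'"
    by (simp add: bar_step_def)
  moreover have "(M, div_A (cartan_entry h \<alpha>) ii M j) \<in> ?E'"
    using m by (force simp: bar_step_def)
  moreover have "(M, div_A (cartan_entry h \<alpha>) ii M j) \<notin> ?E"
    using m by (simp add: bar_moves_def sinks_def)
  ultimately have "?E \<subset> ?E'"
    by blast
  then have "card ?E < card ?E'"
    using E' fin by (meson finite_subset psubset_card_mono)
  moreover have "card ?E' \<le> card (vertices \<times> vertices)"
    using E' fin by (rule card_mono[rotated])
  ultimately show ?thesis
    by linarith
qed

theorem DG_bar_eq_DG:
  assumes "admissible b0" "path_monomial b0 = t_mono k"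
  shows "\<exists>D. DG_bar (cartan_entry h \<alpha>) ii k b0 = Some D \<and> DG (cartan_entry h \<alpha>) ii k = Some D"
proof -
  let ?a = "cartan_entry h \<alpha>"
  let ?S0 = "(({t_mono k}, {}), {(t_mono k, b0)}) :: assoc_graph"
  have valid: "valid_state ?S0"
    using assms by (simp add: valid_state_def)
  have "map_option fst (while_option (\<lambda>S. bar_moves ii S \<noteq> {}) (bar_step ?a ii) ?S0)
      = while_option (\<lambda>D. DG_moves ii D \<noteq> {}) (DG_step ?a ii) (fst ?S0)"
    by (rule while_option_commute_invariant[where P = valid_state])
      (simp_all add: valid bar_step_valid fst_bar_step DG_moves_eq)
  then have "DG_bar ?a ii k b0 = DG ?a ii k"
    by (simp add: DG_bar_def DG_def)
  moreover have "\<exists>S. while_option (\<lambda>S. bar_moves ii S \<noteq> {}) (bar_step ?a ii) ?S0 = Some S"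
  proof (rule measure_while_option_Some)
    fix S assume "valid_state S" "bar_moves ii S \<noteq> {}"
    then show "valid_state (bar_step ?a ii S)
        \<and> card (vertices \<times> vertices) - card (snd (fst (bar_step ?a ii S)))
          < card (vertices \<times> vertices) - card (snd (fst S))"
      by (intro conjI bar_step_valid bar_step_adds_arrow)
  qed (rule valid)
  then obtain S where
    "while_option (\<lambda>S. bar_moves ii S \<noteq> {}) (bar_step ?a ii) ?S0 = Some S" ..
  ultimately show ?thesis
    by (intro exI[of _ "fst S"]) (simp add: DG_bar_def)
qed

text \<open>The \<open>target\<close> weights are consecutive reflections of each other, except at \<open>k\<close>: there the missing reflection
  is compensated by the factor \<open>s\<^sub>i\<close> that appears at the end of the word, so the path rests and \<open>d\<^sub>k = 1\<close>.\<close>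

lemma initial_vector_path:
  fixes \<Lambda> :: "nat \<Rightarrow> 'g \<Rightarrow> complex" and i k :: nat
  defines "target \<equiv> \<lambda>l. weyl_word h \<alpha> (if l < k then drop l ii else drop l ii @ [i]) (\<Lambda> i)"
  assumes \<nu>: "\<nu> = (\<lambda>x. - weyl_word h \<alpha> ii (\<Lambda> i) x)" "\<nu> \<in> X" and k: "k \<in> {1..length ii}"
    and crossing: "simple_reflection h \<alpha> (letter ii k) (weyl_word h \<alpha> (drop k ii) (\<Lambda> i))
      = weyl_word h \<alpha> (drop k ii @ [i]) (\<Lambda> i)"
    and one: "weyl_word h \<alpha> (drop k ii) (\<Lambda> i) (h (letter ii k)) = 1"
    and nonneg: "\<And>l. l \<in> {1..length ii} \<Longrightarrow> l \<noteq> k \<Longrightarrow> \<exists>r\<ge>0. target l (h (letter ii l)) = complex_of_real r"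
  shows "admissible (initial_vector h \<alpha> \<Lambda> ii i k)"
    and "path_monomial (initial_vector h \<alpha> \<Lambda> ii i k) = t_mono k"
proof -
  let ?b = "initial_vector h \<alpha> \<Lambda> ii i k"
  let ?N = "length ii"
  have drop_Cons: "drop l ii = letter ii (Suc l) # drop (Suc l) ii" if "l < ?N" for l
    using Cons_nth_drop_Suc[OF that] by (simp add: letter_def)
  have target_step: "target l = (if Suc l = k then target (Suc l)
      else simple_reflection h \<alpha> (letter ii (Suc l)) (target (Suc l)))" if "l < ?N" for l
    using drop_Cons[OF that] crossing by (auto simp: target_def weyl_word_Cons)
  have target_X: "(\<lambda>x. - target l x) \<in> X" if "l \<le> ?N" for l
    using that
  proof (induction l)
    case 0
    then show ?case using \<nu> k by (simp add: target_def)
  next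
    case (Suc l)
    let ?t = "letter ii (Suc l)"
    have t: "?t \<in> {1..n}"
      using letter_in[of "Suc l"] Suc.prems by simp
    have IH: "(\<lambda>x. - target l x) \<in> X"
      using Suc by simp
    show ?case
    proof (cases "Suc l = k")
      case True
      then show ?thesis using IH target_step[of l] Suc.prems by simp
    next
      case False
      then have "target (Suc l) = simple_reflection h \<alpha> ?t (target l)"
        using target_step[of l] Suc.prems simple_reflection_involution[of \<alpha> ?t h] diagonal[OF t] by simp
      then have "(\<lambda>x. - target (Suc l) x) = simple_reflection h \<alpha> ?t (\<lambda>x. - target l x)"
        by (simp add: simple_reflection_def fun_eq_iff)
      then show ?thesis
        using reflection_closed[OF IH t] by simp
    qed
  qed
  have b_value: "target l (h (letter ii l)) = of_int (?b l)" "?b l \<ge> 0"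
    if l: "l \<in> {1..?N}" "l \<noteq> k" for l
  proof -
    obtain r where r: "r \<ge> 0" "target l (h (letter ii l)) = complex_of_real r"
      using nonneg[OF l] by blast
    have "- target l (h (letter ii l)) \<in> {1, 0, -1}"
      using minuscule[OF target_X letter_in[OF l(1)]] l by simp
    then have "complex_of_real r \<in> {1, 0, -1}"
      using r(2) by (auto simp: minus_equation_iff)
    then have "r = 1 \<or> r = 0 \<or> r = -1"
      by (auto simp flip: of_real_minus simp: complex_eq_iff)
    then obtain z :: int where z: "z \<ge> 0" "target l (h (letter ii l)) = of_int z"
      using r by (metis of_int_0 of_int_1 of_real_0 of_real_1 order_refl zero_le_one
          neg_0_le_iff_le not_one_le_zero)
    have "?b l = int_val (target l (h (letter ii l)))"
      using l by (auto simp: initial_vector_def target_def)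
    then show "target l (h (letter ii l)) = of_int (?b l)" "?b l \<ge> 0"
      using z by simp_all
  qed
  have b_k: "?b k = 0"
    by (simp add: initial_vector_def)
  have path: "path ?b l = (\<lambda>x. - target l x)" if "l \<le> ?N" for l
    using that
  proof (induction l)
    case 0
    have "path ?b 0 = \<nu>"
      by (simp add: path_def)
    also have "\<dots> = (\<lambda>x. - target 0 x)"
      using k unfolding \<nu>(1) by (simp add: target_def)
    finally show ?case .
  next
    case (Suc l)
    show ?case
    proof (cases "Suc l = k")
      case True
      then show ?thesis
        using Suc target_step[of l] b_k path_Suc[of ?b l] by (simp add: fun_eq_iff)
    next
      case False
      then have "target l x = target (Suc l) x - of_int (?b (Suc l)) * \<alpha> (letter ii (Suc l)) x" for x
        using target_step[of l] b_value(1)[of "Suc l"] Suc.prems by (simp add: simple_reflection_def)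
      then show ?thesis
        using Suc by (simp add: fun_eq_iff path_Suc)
    qed
  qed
  have "?b l \<ge> 0" for l
    using b_value(2)[of l] b_k k by (cases "l \<in> {1..?N}"; cases "l = k") (auto simp: initial_vector_def)
  moreover have "?b l = 0" if "l \<notin> {1..?N}" for l
    using that k by (auto simp: initial_vector_def)
  ultimately show "admissible ?b"
    using path target_X by (simp add: admissible_def)
  show "path_monomial ?b = t_mono k"
  proof
    fix l
    consider "l \<notin> {1..?N}" | "l = k" | "l \<in> {1..?N}" "l \<noteq> k"
      by blast
    then show "path_monomial ?b l = t_mono k l"
    proof cases
      case 1
      then show ?thesis using k by (auto simp: path_monomial_def t_mono_def)
    next
      case 2
      have "target k = simple_reflection h \<alpha> (letter ii k) (weyl_word h \<alpha> (drop k ii) (\<Lambda> i))"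
        using crossing by (simp add: target_def)
      then have "- target k (h (letter ii k)) = of_int 1"
        using one diagonal[OF letter_in[OF k]] by (simp add: simple_reflection_def)
      then have "int_val (path ?b k (h (letter ii k))) = 1"
        using path[of k] k int_val_of_int[of 1] by simp
      then show ?thesis
        using 2 k b_k by (simp add: path_monomial_def t_mono_def)
    next
      case 3
      have "path ?b l (h (letter ii l)) = of_int (- ?b l)"
        using path[of l] b_value(1)[OF 3] 3(1) by simp
      then have "int_val (path ?b l (h (letter ii l))) = - ?b l"
        by (simp only: int_val_of_int)
      then show ?thesis
        using 3 by (simp add: path_monomial_def t_mono_def)
    qed
  qed
qed

end

section \<open>Equality of the two graphs\<close>

theorem mainTheorem3:
  fixes scale :: "complex \<Rightarrow> 'g::ab_group_add \<Rightarrow> 'g" and bracket :: "'g \<Rightarrow> 'g \<Rightarrow> 'g"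
    and H :: "'g set" and n :: nat
    and \<alpha> \<Lambda> :: "nat \<Rightarrow> 'g \<Rightarrow> complex" and h :: "nat \<Rightarrow> 'g"
    and w0 :: "('g \<Rightarrow> complex) \<Rightarrow> ('g \<Rightarrow> complex)"
    and scaleV :: "complex \<Rightarrow> 'v::ab_group_add \<Rightarrow> 'v" and act :: "'g \<Rightarrow> 'v \<Rightarrow> 'v"
    and ii :: "nat list" and i k :: nat
  assumes "simple_lie_algebra scale bracket"
    and "lie_algebra.cartan_subalgebra scale bracket H"
    and "lie_algebra.simple_roots scale bracket H n \<alpha>"
    and "\<forall>j\<in>{1..n}. lie_algebra.coroot scale bracket H (\<alpha> j) (h j)"
    and "lie_algebra.fundamental_weights scale H n h \<Lambda>"
    and "longest_element h \<alpha> n w0"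
    and "reduced_word h \<alpha> n ii w0"
    and "i \<in> {1..n}"
    and "lie_module scale bracket scaleV act"
    and "lie_module.is_V scale bracket scaleV act H n \<alpha> (\<lambda>x. - w0 (\<Lambda> i) x)"
    and "\<forall>\<mu> \<in> lie_module.weights scale scaleV act H. \<forall>t\<in>{1..n}. \<mu> (h t) \<in> {1, 0, -1}"
    and "k \<in> {1..length ii}"
    and "weyl_word h \<alpha> (rev (drop k ii)) (\<alpha> (letter ii k)) = \<alpha> i"
  shows "\<exists>D. DG_bar (cartan_entry h \<alpha>) ii k (initial_vector h \<alpha> \<Lambda> ii i k) = Some D
           \<and> DG (cartan_entry h \<alpha>) ii k = Some D"
proof -
  have I: "set ii \<subseteq> {1..n}" and w0: "weyl_word h \<alpha> ii = w0"
    using assms(7) by (auto simp: reduced_word_def)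
  interpret simple_lie_algebra scale bracket
    by fact
  interpret M: lie_module scale bracket scaleV act
    by fact
  obtain B where B: "finite B" "span B = UNIV"
    using finite_dimensional by blast
  note root_data = B assms(2-4)
  have \<Lambda>_dual: "\<Lambda> l \<in> dual H" and \<Lambda>_h: "j \<in> {1..n} \<Longrightarrow> \<Lambda> l (h j) = (if l = j then 1 else 0)"
    if "l \<in> {1..n}" for l j
    using assms(5) that by (auto simp: fundamental_weights_def)
  interpret RS: based_root_system n h \<alpha> "roots H" \<Lambda>
  proof
    show "\<exists>c. \<Lambda> l = (\<lambda>x. \<Sum>j=1..n. c j * \<alpha> j x)" if "l \<in> {1..n}" for l
      using assms(3) \<Lambda>_dual[OF that] unfolding simple_roots_def by blast
  qed (fact simple_coroot_diagonal[OF root_data] cartan_integral[OF root_data] finite_roots[OF root_data]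
      simple_in_roots[OF root_data] root_reflection[OF root_data] root_signed[OF root_data]
      simple_roots_independent[OF root_data] \<Lambda>_h)+
  let ?\<nu> = "\<lambda>x. - w0 (\<Lambda> i) x"
  let ?X = "M.weights H"
  interpret MP: minuscule_paths n h \<alpha> ?X ?\<nu> ii
  proof
    fix \<mu> t assume \<mu>: "\<mu> \<in> ?X" and t: "t \<in> {1..n}"
    show "\<mu> (h t) \<in> {1, 0, -1}"
      using assms(11) \<mu> t by blast
    obtain e f where sl2: "sl2_triple H (\<alpha> t) e f (h t)"
      using simple_sl2_triple[OF root_data t] .
    show "simple_reflection h \<alpha> t \<mu> \<in> ?X"
      unfolding simple_reflection_def
      by (rule M.weights_reflection[OF sl2 _ \<mu>]) (use assms(11) t in blast)
  qed (fact RS.diagonal cartan_off_diagonal[OF root_data] I)+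
  have \<nu>: "?\<nu> \<in> ?X"
    using assms(10) unfolding M.is_V_def M.has_highest_weight_def M.weights_def by blast
  let ?c = "letter ii k" and ?us = "drop k ii"
  have c: "?c \<in> {1..n}"
    using MP.letter_in[OF assms(12)] .
  have us: "set ?us \<subseteq> {1..n}" "set (rev ?us) \<subseteq> {1..n}"
    using I by (auto dest: in_set_dropD)
  have split: "ii = take (l - 1) ii @ letter ii l # drop l ii" if "l \<in> {1..length ii}" for l
    using id_take_nth_drop[of "l - 1" ii] that by (auto simp: letter_def)
  have nonneg: "\<exists>r\<ge>0. weyl_word h \<alpha> (if l < k then drop l ii else drop l ii @ [i]) (\<Lambda> i) (h (letter ii l))
      = complex_of_real r" if l: "l \<in> {1..length ii}" "l \<noteq> k" for l
  proof (cases "l < k")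
    case True
    have "RS.positive (weyl_word h \<alpha> (rev (drop l ii)) (\<alpha> (letter ii l)))"
      using RS.reduced_word_factor_positive[OF assms(7), of _ _ _ "[]"] split[OF l(1)] by simp
    moreover have "set (drop l ii) \<subseteq> {1..n}"
      using I by (auto dest: in_set_dropD)
    ultimately show ?thesis
      using RS.positive_coroot_pairing[OF _ MP.letter_in[OF l(1)] assms(8)] True by simp
  next
    case False
    then have kl: "k < l"
      using l(2) by simp
    define vs where "vs = take (l - 1 - k) ?us"
    have us_split: "?us = vs @ letter ii l # drop l ii"
      using id_take_nth_drop[of "l - 1 - k" ?us] kl l(1) by (simp add: vs_def letter_def)
    have "ii = take (k - 1) ii @ ?c # vs @ letter ii l # drop l ii"
      using split[OF assms(12)] us_split by simp
    then show ?thesis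
      using RS.pairing_beyond_crossing[OF assms(7) _ assms(8)] assms(13) us_split False by simp
  qed
  show ?thesis
  proof (rule MP.DG_bar_eq_DG)
    have crossing: "simple_reflection h \<alpha> ?c (weyl_word h \<alpha> ?us (\<Lambda> i)) = weyl_word h \<alpha> (?us @ [i]) (\<Lambda> i)"
    proof -
      have "weyl_word h \<alpha> (rev ?us) (simple_reflection h \<alpha> ?c (weyl_word h \<alpha> ?us (\<Lambda> i)))
          = simple_reflection h \<alpha> i (\<Lambda> i)"
        using RS.conjugate_reflection[OF us(2) c assms(8,13), of "\<Lambda> i"] by simp
      then have "weyl_word h \<alpha> ?us (weyl_word h \<alpha> (rev ?us) (simple_reflection h \<alpha> ?c (weyl_word h \<alpha> ?us (\<Lambda> i))))
          = weyl_word h \<alpha> ?us (simple_reflection h \<alpha> i (\<Lambda> i))"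
        by simp
      then show ?thesis
        by (simp add: RS.W_rev_cancel[OF us(1)] weyl_word_append weyl_word_Cons weyl_word_Nil)
    qed
    have one: "weyl_word h \<alpha> ?us (\<Lambda> i) (h ?c) = 1"
      using RS.coroot_transport[OF us(2) c assms(8,13), of "\<Lambda> i"] RS.\<Lambda>_coroot[OF assms(8,8)] by simp
    have \<nu>_eq: "?\<nu> = (\<lambda>x. - weyl_word h \<alpha> ii (\<Lambda> i) x)"
      by (simp add: w0)
    show "MP.admissible (initial_vector h \<alpha> \<Lambda> ii i k)"
      and "MP.path_monomial (initial_vector h \<alpha> \<Lambda> ii i k) = t_mono k"
      using MP.initial_vector_path[where \<Lambda> = \<Lambda> and i = i and k = k, OF \<nu>_eq \<nu> assms(12) crossing one nonneg] by simp_all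
  qed
qed

end
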